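(* Suppose $\kappa$ is a Mahlo cardinal and $p\in\mathbb{Q}(\kappa)$. Then $p\Vdash_{\mathbb{Q}(\kappa)}{\rm Refl}_0(\kappa)$ if and only if $p\Vdash_{\mathbb{Q}(\kappa)}\square_1(\kappa)$.
   Context: A set $C\subseteq\alpha$ is $1$-club in $\alpha$ if it is stationary in $\alpha$ and contains every inaccessible $\beta<\alpha$ with $C\cap\beta$ stationary in $\beta$. Let ${\rm inacc}(\kappa)$ be the set of inaccessible cardinals below $\kappa$. The poset $\mathbb{Q}(\kappa)$ consists of sequences $q$ with $\mathrm{dom}(q)={\rm inacc}(\kappa)\cap(\gamma^q+1)$ for some $\gamma^q<\kappa$, such that $q(\alpha)=C^q_\alpha$ is a $1$-club subset of $\alpha$ for each $\alpha\in\mathrm{dom}(q)$, and for $\alpha,\beta\in\mathrm{dom}(q)$, if $C^q_\beta\cap\alpha$ is stationary in $\alpha$ then $C^q_\alpha=C^q_\beta\cap\alpha$; ordered by end-extension ($p\le q$ iff $p$ end-extends $q$). ${\rm Refl}_0(\kappa)$: $\kappa$ is inaccessible and every stationary $S\subseteq\kappa$ has some inaccessible $\alpha<\kappa$ with $S\cap\alpha$ stationary in $\alpha$. $\square_1(\kappa)$ asserts that there is a sequence $\langle C_\alpha:\alpha\in{\rm inacc}(\kappa)\rangle$ of $1$-clubs $C_\alpha\subseteq\alpha$ such that for $\alpha<\beta$ in ${\rm inacc}(\kappa)$, if $C_\beta\cap\alpha$ is stationary in $\alpha$ then $C_\alpha=C_\beta\cap\alpha$, and there is no $1$-club $C\subseteq\kappa$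 with $C_\alpha=C\cap\alpha$ for every $\alpha\in{\rm inacc}(\kappa)$ such that $C\cap\alpha$ is stationary in $\alpha$. *)

theory Defs
  imports Main "HOL-Library.Countable_Set" "HOL-Library.Equipollence"
begin

text \<open>
  The ordinal \<open>\<kappa>\<close> is the order type of a well-ordered type \<open>'k\<close>. An ordinal \<open>\<alpha> \<le> \<kappa>\<close> is represented
  by its set of predecessors, an initial segment \<open>A\<close> of \<open>'k\<close>: \<open>A = {..<\<alpha>}\<close> if \<open>\<alpha> < \<kappa>\<close>, and
  \<open>A = UNIV\<close> for \<open>\<kappa>\<close> itself.
\<close>

section \<open>The ground model\<close>

text \<open>
  Uncountable, regular and strong limit. For uncountable \<open>A\<close> the second clause also excludes successor
  ordinals and ordinals that are not cardinals.
\<close>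
definition inaccessible :: "'k::wellorder set \<Rightarrow> bool" where
  "inaccessible A \<longleftrightarrow>
     uncountable A \<and>
     (\<forall>\<beta>\<in>A. \<forall>f. f ` {..<\<beta>} \<subseteq> A \<longrightarrow> \<not> (\<forall>x\<in>A. \<exists>\<xi><\<beta>. x \<le> f \<xi>)) \<and>
     (\<forall>\<beta>\<in>A. Pow {..<\<beta>} \<prec> A)"

definition inacc :: "'k::wellorder set" where
  "inacc = {\<alpha>. inaccessible {..<\<alpha>}}"

definition club :: "'k::wellorder set \<Rightarrow> 'k set \<Rightarrow> bool" where
  "club A C \<longleftrightarrow>
     C \<subseteq> A \<and>
     (\<forall>x\<in>A. \<exists>y\<in>C. x \<le> y) \<and>
     (\<forall>\<delta>\<in>A. (\<exists>x. x < \<delta>) \<and> (\<forall>x<\<delta>. \<exists>y\<in>C. x < y \<and> y < \<delta>) \<longrightarrow> \<delta> \<in> C)"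

definition stationary :: "'k::wellorder set \<Rightarrow> 'k set \<Rightarrow> bool" where
  "stationary A S \<longleftrightarrow> S \<subseteq> A \<and> (\<forall>C. club A C \<longrightarrow> (\<exists>x. x \<in> C \<and> x \<in> S))"

definition one_club :: "'k::wellorder set \<Rightarrow> 'k set \<Rightarrow> bool" where
  "one_club A C \<longleftrightarrow>
     stationary A C \<and>
     (\<forall>\<beta>\<in>A. inaccessible {..<\<beta>} \<and> stationary {..<\<beta>} (C \<inter> {..<\<beta>}) \<longrightarrow> \<beta> \<in> C)"

definition Mahlo :: "'k::wellorder set \<Rightarrow> bool" where
  "Mahlo A \<longleftrightarrow> inaccessible A \<and> stationary A (A \<inter> inacc)"


section \<open>The poset\<close>

definition is_condition :: "('k::wellorder \<rightharpoonup> 'k set) \<Rightarrow> bool" where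
  "is_condition q \<longleftrightarrow>
     (\<exists>\<gamma>. dom q = inacc \<inter> {..\<gamma>}) \<and>
     (\<forall>\<alpha>\<in>dom q. one_club {..<\<alpha>} (the (q \<alpha>))) \<and>
     (\<forall>\<alpha>\<in>dom q. \<forall>\<beta>\<in>dom q.
        stationary {..<\<alpha>} (the (q \<beta>) \<inter> {..<\<alpha>}) \<longrightarrow> the (q \<alpha>) = the (q \<beta>) \<inter> {..<\<alpha>})"

definition end_extends :: "('k::wellorder \<rightharpoonup> 'k set) \<Rightarrow> ('k \<rightharpoonup> 'k set) \<Rightarrow> bool" where
  "end_extends p q \<longleftrightarrow> q \<subseteq>\<^sub>m p \<and> (\<forall>\<alpha>\<in>dom p - dom q. \<forall>\<beta>\<in>dom q. \<beta> < \<alpha>)"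

lemma is_condition_empty: "is_condition (Map.empty :: 'k::wellorder \<rightharpoonup> 'k set)"
proof -
  define b :: 'k where "b = (LEAST x. True)"
  have "b \<le> x" for x
    unfolding b_def by (rule Least_le) simp
  then have "{..<b} = {}" "{..b} = {b}"
    by (auto simp: order.antisym simp flip: not_le)
  then have "inacc \<inter> {..b} = {}"
    by (auto simp: inacc_def inaccessible_def)
  then show ?thesis
    by (auto simp: is_condition_def)
qed

typedef (overloaded) ('k::wellorder) Q = "{q :: 'k \<rightharpoonup> 'k set. is_condition q}"
  using is_condition_empty by blast

instantiation Q :: (wellorder) order
begin

definition less_eq_Q :: "'a Q \<Rightarrow> 'a Q \<Rightarrow> bool" where
  "p \<le> q \<longleftrightarrow> end_extends (Rep_Q p) (Rep_Q q)"

definition less_Q :: "'a Q \<Rightarrow> 'a Q \<Rightarrow> bool" where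
  "less_Q p q \<longleftrightarrow> p \<le> q \<and> \<not> q \<le> p"

instance
proof
  fix p q r :: "'a Q"
  show "p < q \<longleftrightarrow> p \<le> q \<and> \<not> q \<le> p"
    by (rule less_Q_def)
  show "p \<le> p"
    by (simp add: less_eq_Q_def end_extends_def)
  show "p \<le> r" if "p \<le> q" "q \<le> r"
    using that map_le_implies_dom_le[of "Rep_Q r" "Rep_Q q"]
    unfolding less_eq_Q_def end_extends_def by (blast intro: map_le_trans)
  show "p = q" if "p \<le> q" "q \<le> p"
    using that unfolding less_eq_Q_def end_extends_def
    by (metis Rep_Q_inject map_le_antisym)
qed

end


section \<open>The forcing relation\<close>

text \<open>
  The usual recursive definition of forcing over a partial order \<open>'p\<close> (smaller conditions are
  stronger), as a shallow embedding: a sentence of the forcing language is the set of conditions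
  forcing it. Every subset of a ground model set \<open>'x\<close> in the generic extension is the value of a
  name of the form \<open>{(s, x\<^sup>\<or>), \<dots>}\<close> with \<open>x\<close> in \<open>'x\<close>, so quantification over subsets of \<open>'x\<close> in
  the extension is quantification over the type \<open>('p, 'x) name\<close>. Functions, relations and
  sequences of sets are subsets of a product. Ground model objects stand for their check names;
  as forcing adds no ordinals, quantification over ordinals below \<open>\<kappa>\<close> in the extension is
  quantification over the type \<open>'k\<close>.
\<close>

type_synonym ('p, 'x) name = "('p \<times> 'x) set"
type_synonym 'p sentence = "'p \<Rightarrow> bool"

definition forces :: "'p::order \<Rightarrow> 'p sentence \<Rightarrow> bool" (infix "\<tturnstile>" 5) where
  "(p \<tturnstile> \<phi>) \<longleftrightarrow> \<phi> p"

definition fground :: "bool \<Rightarrow> 'p::order sentence" ("\<guillemotleft>_\<guillemotright>") where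
  "\<guillemotleft>b\<guillemotright> = (\<lambda>p. b)"

definition fmem :: "'x \<Rightarrow> ('p, 'x) name \<Rightarrow> 'p::order sentence" (infix "\<^bold>\<in>" 50) where
  "(x \<^bold>\<in> \<tau>) = (\<lambda>p. \<forall>q\<le>p. \<exists>r\<le>q. \<exists>s. (s, x) \<in> \<tau> \<and> r \<le> s)"

definition fnot :: "'p::order sentence \<Rightarrow> 'p sentence" ("\<^bold>\<not> _" [40] 40) where
  "(\<^bold>\<not> \<phi>) = (\<lambda>p. \<forall>q\<le>p. \<not> (q \<tturnstile> \<phi>))"

definition fand :: "'p::order sentence \<Rightarrow> 'p sentence \<Rightarrow> 'p sentence" (infixr "\<^bold>\<and>" 35) where
  "(\<phi> \<^bold>\<and> \<psi>) = (\<lambda>p. (p \<tturnstile> \<phi>) \<and> (p \<tturnstile> \<psi>))"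

definition fall :: "('y \<Rightarrow> 'p::order sentence) \<Rightarrow> 'p sentence" (binder "\<^bold>\<forall>" 10) where
  "(\<^bold>\<forall>y. \<phi> y) = (\<lambda>p. \<forall>y. (p \<tturnstile> \<phi> y))"

definition fimp :: "'p::order sentence \<Rightarrow> 'p sentence \<Rightarrow> 'p sentence" (infixr "\<^bold>\<longrightarrow>" 25) where
  "(\<phi> \<^bold>\<longrightarrow> \<psi>) = (\<^bold>\<not> (\<phi> \<^bold>\<and> \<^bold>\<not> \<psi>))"

definition fiff :: "'p::order sentence \<Rightarrow> 'p sentence \<Rightarrow> 'p sentence" (infixr "\<^bold>\<longleftrightarrow>" 25) where
  "(\<phi> \<^bold>\<longleftrightarrow> \<psi>) = ((\<phi> \<^bold>\<longrightarrow> \<psi>) \<^bold>\<and> (\<psi> \<^bold>\<longrightarrow> \<phi>))"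

definition fex :: "('y \<Rightarrow> 'p::order sentence) \<Rightarrow> 'p sentence" (binder "\<^bold>\<exists>" 10) where
  "(\<^bold>\<exists>y. \<phi> y) = (\<^bold>\<not> (\<^bold>\<forall>y. \<^bold>\<not> \<phi> y))"

definition fsubset :: "('p, 'x) name \<Rightarrow> 'x set \<Rightarrow> 'p::order sentence" (infix "\<^bold>\<subseteq>" 50) where
  "(\<tau> \<^bold>\<subseteq> A) = (\<^bold>\<forall>x. x \<^bold>\<in> \<tau> \<^bold>\<longrightarrow> \<guillemotleft>x \<in> A\<guillemotright>)"

definition feq :: "('p, 'x) name \<Rightarrow> ('p, 'x) name \<Rightarrow> 'p::order sentence" (infix "\<^bold>=" 50) where
  "(\<sigma> \<^bold>= \<tau>) = (\<^bold>\<forall>x. x \<^bold>\<in> \<sigma> \<^bold>\<longleftrightarrow> x \<^bold>\<in> \<tau>)"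

text \<open>Names for \<open>\<tau> \<inter> A\<close> with \<open>A\<close> in the ground model, and for the entry with index \<open>\<alpha>\<close> of a sequence of sets.\<close>

definition name_restrict :: "('p, 'x) name \<Rightarrow> 'x set \<Rightarrow> ('p, 'x) name" (infixl "\<restriction>" 70) where
  "\<tau> \<restriction> A = {(s, x). (s, x) \<in> \<tau> \<and> x \<in> A}"

definition name_at :: "('p, 'y \<times> 'x) name \<Rightarrow> 'y \<Rightarrow> ('p, 'x) name" (infixl "\<^bold>!" 75) where
  "\<tau> \<^bold>! \<alpha> = {(s, x). (s, (\<alpha>, x)) \<in> \<tau>}"


section \<open>The notions above, interpreted in the generic extension\<close>

definition function_G :: "'x set \<Rightarrow> 'y set \<Rightarrow> ('p, 'x \<times> 'y) name \<Rightarrow> 'p::order sentence" where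
  "function_G A B F =
     (F \<^bold>\<subseteq> A \<times> B \<^bold>\<and>
      (\<^bold>\<forall>x. \<guillemotleft>x \<in> A\<guillemotright> \<^bold>\<longrightarrow> (\<^bold>\<exists>y. (x, y) \<^bold>\<in> F)) \<^bold>\<and>
      (\<^bold>\<forall>x y z. (x, y) \<^bold>\<in> F \<^bold>\<and> (x, z) \<^bold>\<in> F \<^bold>\<longrightarrow> \<guillemotleft>y = z\<guillemotright>))"

definition uncountable_G :: "'x set \<Rightarrow> 'p::order sentence" where
  "uncountable_G A =
     (\<^bold>\<not> (\<^bold>\<exists>F :: ('p, 'x \<times> nat) name.
        function_G A UNIV F \<^bold>\<and> (\<^bold>\<forall>x y n. (x, n) \<^bold>\<in> F \<^bold>\<and> (y, n) \<^bold>\<in> F \<^bold>\<longrightarrow> \<guillemotleft>x = y\<guillemotright>)))"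

text \<open>
  The last clause says that no \<open>\<langle>R\<^sub>\<xi> : \<xi> \<in> A\<rangle>\<close> is an injection of \<open>A\<close> into the power set of some \<open>\<beta>\<close> in \<open>A\<close>.
\<close>
definition inaccessible_G :: "'k::wellorder set \<Rightarrow> 'p::order sentence" where
  "inaccessible_G A =
     (uncountable_G A \<^bold>\<and>
      (\<^bold>\<forall>\<beta>. \<guillemotleft>\<beta> \<in> A\<guillemotright> \<^bold>\<longrightarrow> (\<^bold>\<forall>F :: ('p, 'k \<times> 'k) name. function_G {..<\<beta>} A F \<^bold>\<longrightarrow>
         \<^bold>\<not> (\<^bold>\<forall>x. \<guillemotleft>x \<in> A\<guillemotright> \<^bold>\<longrightarrow> (\<^bold>\<exists>\<xi> y. (\<xi>, y) \<^bold>\<in> F \<^bold>\<and> \<guillemotleft>x \<le> y\<guillemotright>)))) \<^bold>\<and>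
      (\<^bold>\<forall>\<beta>. \<guillemotleft>\<beta> \<in> A\<guillemotright> \<^bold>\<longrightarrow> \<^bold>\<not> (\<^bold>\<exists>R :: ('p, 'k \<times> 'k) name. R \<^bold>\<subseteq> A \<times> {..<\<beta>} \<^bold>\<and>
         (\<^bold>\<forall>\<xi> \<eta>. \<guillemotleft>\<xi> \<in> A \<and> \<eta> \<in> A\<guillemotright> \<^bold>\<and> R \<^bold>! \<xi> \<^bold>= R \<^bold>! \<eta> \<^bold>\<longrightarrow> \<guillemotleft>\<xi> = \<eta>\<guillemotright>))))"

definition club_G :: "'k::wellorder set \<Rightarrow> ('p, 'k) name \<Rightarrow> 'p::order sentence" where
  "club_G A C =
     (C \<^bold>\<subseteq> A \<^bold>\<and>
      (\<^bold>\<forall>x. \<guillemotleft>x \<in> A\<guillemotright> \<^bold>\<longrightarrow> (\<^bold>\<exists>y. y \<^bold>\<in> C \<^bold>\<and> \<guillemotleft>x \<le> y\<guillemotright>)) \<^bold>\<and>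
      (\<^bold>\<forall>\<delta>. \<guillemotleft>\<delta> \<in> A\<guillemotright> \<^bold>\<and> \<guillemotleft>\<exists>x. x < \<delta>\<guillemotright> \<^bold>\<and>
         (\<^bold>\<forall>x. \<guillemotleft>x < \<delta>\<guillemotright> \<^bold>\<longrightarrow> (\<^bold>\<exists>y. y \<^bold>\<in> C \<^bold>\<and> \<guillemotleft>x < y \<and> y < \<delta>\<guillemotright>)) \<^bold>\<longrightarrow> \<delta> \<^bold>\<in> C))"

definition stationary_G :: "'k::wellorder set \<Rightarrow> ('p, 'k) name \<Rightarrow> 'p::order sentence" where
  "stationary_G A S =
     (S \<^bold>\<subseteq> A \<^bold>\<and> (\<^bold>\<forall>C. club_G A C \<^bold>\<longrightarrow> (\<^bold>\<exists>x. x \<^bold>\<in> C \<^bold>\<and> x \<^bold>\<in> S)))"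

definition one_club_G :: "'k::wellorder set \<Rightarrow> ('p, 'k) name \<Rightarrow> 'p::order sentence" where
  "one_club_G A C =
     (stationary_G A C \<^bold>\<and>
      (\<^bold>\<forall>\<beta>. \<guillemotleft>\<beta> \<in> A\<guillemotright> \<^bold>\<and> inaccessible_G {..<\<beta>} \<^bold>\<and> stationary_G {..<\<beta>} (C \<restriction> {..<\<beta>}) \<^bold>\<longrightarrow> \<beta> \<^bold>\<in> C))"

definition Refl0_G :: "'k::wellorder set \<Rightarrow> 'p::order sentence" where
  "Refl0_G \<kappa> =
     (inaccessible_G \<kappa> \<^bold>\<and>
      (\<^bold>\<forall>S :: ('p, 'k) name. stationary_G \<kappa> S \<^bold>\<longrightarrow>
         (\<^bold>\<exists>\<alpha>. \<guillemotleft>\<alpha> \<in> \<kappa>\<guillemotright> \<^bold>\<and> inaccessible_G {..<\<alpha>} \<^bold>\<and> stationary_G {..<\<alpha>} (S \<restriction> {..<\<alpha>}))))"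

text \<open>
  The sequence is a name for a subset of \<open>\<kappa> \<times> \<kappa>\<close>; its entries at indices that are not
  inaccessible in the extension are irrelevant.
\<close>
definition square1_G :: "'k::wellorder set \<Rightarrow> 'p::order sentence" where
  "square1_G \<kappa> =
     (\<^bold>\<exists>C :: ('p, 'k \<times> 'k) name.
        (\<^bold>\<forall>\<alpha>. \<guillemotleft>\<alpha> \<in> \<kappa>\<guillemotright> \<^bold>\<and> inaccessible_G {..<\<alpha>} \<^bold>\<longrightarrow> one_club_G {..<\<alpha>} (C \<^bold>! \<alpha>)) \<^bold>\<and>
        (\<^bold>\<forall>\<alpha> \<beta>. \<guillemotleft>\<alpha> \<in> \<kappa> \<and> \<beta> \<in> \<kappa> \<and> \<alpha> < \<beta>\<guillemotright> \<^bold>\<and> inaccessible_G {..<\<alpha>} \<^bold>\<and> inaccessible_G {..<\<beta>} \<^bold>\<and>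
           stationary_G {..<\<alpha>} (C \<^bold>! \<beta> \<restriction> {..<\<alpha>}) \<^bold>\<longrightarrow> C \<^bold>! \<alpha> \<^bold>= C \<^bold>! \<beta> \<restriction> {..<\<alpha>}) \<^bold>\<and>
        \<^bold>\<not> (\<^bold>\<exists>D :: ('p, 'k) name. one_club_G \<kappa> D \<^bold>\<and>
           (\<^bold>\<forall>\<alpha>. \<guillemotleft>\<alpha> \<in> \<kappa>\<guillemotright> \<^bold>\<and> inaccessible_G {..<\<alpha>} \<^bold>\<and> stationary_G {..<\<alpha>} (D \<restriction> {..<\<alpha>}) \<^bold>\<longrightarrow>
              C \<^bold>! \<alpha> \<^bold>= D \<restriction> {..<\<alpha>})))"

end

theory Submission
  imports Defs
begin

text \<open>
  A chain of conditions indexed by \<open>\<lambda> < \<kappa>\<close> whose members have length at least \<open>\<lambda>\<close> has a union whose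
  length is singular or attained, so the union is a condition. Hence \<open>Q(\<kappa>)\<close> is \<open><\<kappa>\<close>-distributive,
  and inaccessibility, stationarity and \<open>1\<close>-clubs below \<open>\<kappa>\<close> are absolute.

  If \<open>\<square>\<^sub>1(\<kappa>)\<close> holds in the extension, a stationary set without inaccessible reflection points would
  be a thread. Conversely, assume \<open>Refl\<^sub>0(\<kappa>)\<close> and let \<open>D\<close> be a thread through the generic sequence.
  The ordinals \<open>\<delta>\<close> such that \<open>D \<inter> \<delta>\<close> is decided by proper initial segments of the generic
  sequence up to \<open>\<delta>\<close> form a club \<open>E\<close>. Let \<open>\<alpha>\<close> be the least inaccessible at which \<open>D \<inter> E\<close> can be made
  to reflect. Then \<open>D \<inter> E \<inter> \<alpha>\<close> does not reflect below \<open>\<alpha>\<close>, so any stationary subset of it is a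
  legal choice of \<open>C\<^sub>\<alpha>\<close>. Choosing one that misses a point contradicts \<open>C\<^sub>\<alpha> = D \<inter> \<alpha>\<close>.
\<close>

section \<open>Forcing over a partial order\<close>

text \<open>The regular open sets of conditions: closed under strengthening, and containing every
  condition below which they are dense. All sentences built by the forcing connectives are of this
  kind, so they may be verified on a dense set of extensions.\<close>

definition regular_sentence :: "'p::order sentence \<Rightarrow> bool" where
  "regular_sentence \<phi> \<longleftrightarrow>
     (\<forall>p q. \<phi> p \<longrightarrow> q \<le> p \<longrightarrow> \<phi> q) \<and> (\<forall>p. (\<forall>q\<le>p. \<exists>r\<le>q. \<phi> r) \<longrightarrow> \<phi> p)"

lemma regular_mono: "regular_sentence \<phi> \<Longrightarrow> \<phi> p \<Longrightarrow> q \<le> p \<Longrightarrow> \<phi> q"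
  unfolding regular_sentence_def by blast

lemma regular_dense: "regular_sentence \<phi> \<Longrightarrow> (\<And>q. q \<le> p \<Longrightarrow> \<exists>r\<le>q. \<phi> r) \<Longrightarrow> \<phi> p"
  unfolding regular_sentence_def by blast

lemma regularI:
  assumes "\<And>p q. \<phi> p \<Longrightarrow> q \<le> p \<Longrightarrow> \<phi> q" "\<And>p. (\<And>q. q \<le> p \<Longrightarrow> \<exists>r\<le>q. \<phi> r) \<Longrightarrow> \<phi> p"
  shows "regular_sentence \<phi>"
  unfolding regular_sentence_def using assms by blast

lemma fground_iff: "\<guillemotleft>b\<guillemotright> p \<longleftrightarrow> b"
  by (simp add: fground_def)

lemma fand_iff: "(\<phi> \<^bold>\<and> \<psi>) p \<longleftrightarrow> \<phi> p \<and> \<psi> p"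
  by (simp add: fand_def forces_def)

lemma fall_iff: "(\<^bold>\<forall>y. \<phi> y) p \<longleftrightarrow> (\<forall>y. \<phi> y p)"
  by (simp add: fall_def forces_def)

lemma fnot_iff: "(\<^bold>\<not> \<phi>) p \<longleftrightarrow> (\<forall>q\<le>p. \<not> \<phi> q)"
  by (simp add: fnot_def forces_def)

lemma fex_iff: "(\<^bold>\<exists>y. \<phi> y) p \<longleftrightarrow> (\<forall>q\<le>p. \<exists>y. \<exists>r\<le>q. \<phi> y r)"
  by (simp add: fex_def fall_iff fnot_iff)

text \<open>The encoding by negation only gives a dense set of conditions forcing \<psi> below one
  that forces \<phi>; regularity of \<psi> turns density into forcing.\<close>

lemma fimp_iff:
  assumes "regular_sentence \<phi>" "regular_sentence \<psi>"
  shows "(\<phi> \<^bold>\<longrightarrow> \<psi>) p \<longleftrightarrow> (\<forall>q\<le>p. \<phi> q \<longrightarrow> \<psi> q)"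
proof
  assume L: "(\<phi> \<^bold>\<longrightarrow> \<psi>) p"
  show "\<forall>q\<le>p. \<phi> q \<longrightarrow> \<psi> q"
  proof (intro allI impI)
    fix q assume q: "q \<le> p" "\<phi> q"
    show "\<psi> q"
    proof (rule regular_dense[OF assms(2)])
      fix r assume r: "r \<le> q"
      with q have "r \<le> p" "\<phi> r"
        by (auto intro: regular_mono[OF assms(1)])
      then show "\<exists>s\<le>r. \<psi> s"
        using L by (auto simp: fimp_def fnot_iff fand_iff)
    qed
  qed
next
  assume "\<forall>q\<le>p. \<phi> q \<longrightarrow> \<psi> q"
  then show "(\<phi> \<^bold>\<longrightarrow> \<psi>) p"
    by (auto simp: fimp_def fnot_iff fand_iff)
qed

text \<open>Each existential quantifier costs one passage to an extension; regularity allows two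
  such passages to be merged into one.\<close>

lemma fex_fex_iff:
  assumes "\<And>x y. regular_sentence (\<phi> x y)"
  shows "(\<^bold>\<exists>x y. \<phi> x y) p \<longleftrightarrow> (\<forall>q\<le>p. \<exists>x y. \<exists>r\<le>q. \<phi> x y r)"
proof
  assume L: "(\<^bold>\<exists>x y. \<phi> x y) p"
  show "\<forall>q\<le>p. \<exists>x y. \<exists>r\<le>q. \<phi> x y r"
  proof (intro allI impI)
    fix q assume "q \<le> p"
    with L obtain x r where r: "r \<le> q" "(\<^bold>\<exists>y. \<phi> x y) r"
      unfolding fex_iff[of "\<lambda>x. \<^bold>\<exists>y. \<phi> x y"] by blast
    then obtain y s where "s \<le> r" "\<phi> x y s"
      unfolding fex_iff by blast
    with r show "\<exists>x y. \<exists>r\<le>q. \<phi> x y r"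
      using order_trans by blast
  qed
next
  assume R: "\<forall>q\<le>p. \<exists>x y. \<exists>r\<le>q. \<phi> x y r"
  show "(\<^bold>\<exists>x y. \<phi> x y) p"
    unfolding fex_iff[of "\<lambda>x. \<^bold>\<exists>y. \<phi> x y"]
  proof (intro allI impI)
    fix q assume "q \<le> p"
    with R obtain x y r where r: "r \<le> q" "\<phi> x y r"
      by blast
    then have "(\<^bold>\<exists>y. \<phi> x y) r"
      unfolding fex_iff using regular_mono[OF assms] by blast
    with r show "\<exists>x. \<exists>r\<le>q. (\<^bold>\<exists>y. \<phi> x y) r"
      by blast
  qed
qed

lemma fnot_fex_iff:
  assumes "\<And>y. regular_sentence (\<phi> y)"
  shows "(\<^bold>\<not> (\<^bold>\<exists>y. \<phi> y)) p \<longleftrightarrow> (\<forall>y. \<forall>q\<le>p. \<not> \<phi> y q)"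
proof
  assume L: "(\<^bold>\<not> (\<^bold>\<exists>y. \<phi> y)) p"
  show "\<forall>y. \<forall>q\<le>p. \<not> \<phi> y q"
  proof (intro allI impI notI)
    fix y q assume q: "q \<le> p" "\<phi> y q"
    with L obtain r where "r \<le> q" "\<forall>y. \<forall>s\<le>r. \<not> \<phi> y s"
      unfolding fnot_iff fex_iff by blast
    then show False
      using regular_mono[OF assms q(2)] by blast
  qed
next
  assume R: "\<forall>y. \<forall>q\<le>p. \<not> \<phi> y q"
  then show "(\<^bold>\<not> (\<^bold>\<exists>y. \<phi> y)) p"
    unfolding fnot_iff fex_iff by (metis order_refl order_trans)
qed

section \<open>Regularity of the forcing connectives\<close>

lemma regular_fground [simp]: "regular_sentence \<guillemotleft>b\<guillemotright>"
  by (rule regularI) (auto simp: fground_iff)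

lemma regular_fand [simp]:
  "regular_sentence \<phi> \<Longrightarrow> regular_sentence \<psi> \<Longrightarrow> regular_sentence (\<phi> \<^bold>\<and> \<psi>)"
  by (rule regularI; unfold fand_iff) (metis regular_mono, metis regular_dense)

lemma regular_fall [simp]:
  "(\<And>y. regular_sentence (\<phi> y)) \<Longrightarrow> regular_sentence (\<^bold>\<forall>y. \<phi> y)"
  by (rule regularI; unfold fall_iff) (metis regular_mono, metis regular_dense)

lemma regular_fnot [simp]: "regular_sentence \<phi> \<Longrightarrow> regular_sentence (\<^bold>\<not> \<phi>)"
proof (rule regularI)
  show "(\<^bold>\<not> \<phi>) q" if "(\<^bold>\<not> \<phi>) p" "q \<le> p" for p q
    using that order_trans unfolding fnot_iff by blast
  show "(\<^bold>\<not> \<phi>) p" if \<phi>: "regular_sentence \<phi>" and *: "\<And>q. q \<le> p \<Longrightarrow> \<exists>r\<le>q. (\<^bold>\<not> \<phi>) r" for p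
    unfolding fnot_iff
  proof (intro allI impI notI)
    fix q assume "q \<le> p" "\<phi> q"
    moreover obtain r where "r \<le> q" "(\<^bold>\<not> \<phi>) r"
      using * \<open>q \<le> p\<close> by blast
    ultimately show False
      using regular_mono[OF \<phi>] by (auto simp: fnot_iff)
  qed
qed

lemma regular_fimp [simp]:
  "regular_sentence \<phi> \<Longrightarrow> regular_sentence \<psi> \<Longrightarrow> regular_sentence (\<phi> \<^bold>\<longrightarrow> \<psi>)"
  by (simp add: fimp_def)

lemma regular_fiff [simp]:
  "regular_sentence \<phi> \<Longrightarrow> regular_sentence \<psi> \<Longrightarrow> regular_sentence (\<phi> \<^bold>\<longleftrightarrow> \<psi>)"
  by (simp add: fiff_def)

lemma regular_fex [simp]:
  "(\<And>y. regular_sentence (\<phi> y)) \<Longrightarrow> regular_sentence (\<^bold>\<exists>y. \<phi> y)"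
  by (simp add: fex_def)

lemma regular_fmem [simp]: "regular_sentence (x \<^bold>\<in> \<tau>)"
proof (rule regularI)
  show "(x \<^bold>\<in> \<tau>) q" if "(x \<^bold>\<in> \<tau>) p" "q \<le> p" for p q
    using that order_trans unfolding fmem_def by blast
  show "(x \<^bold>\<in> \<tau>) p" if *: "\<And>q. q \<le> p \<Longrightarrow> \<exists>r\<le>q. (x \<^bold>\<in> \<tau>) r" for p
    unfolding fmem_def
  proof (intro allI impI)
    fix q assume "q \<le> p"
    then obtain r where r: "r \<le> q" "(x \<^bold>\<in> \<tau>) r"
      using * by blast
    then obtain t s where "t \<le> r" "(s, x) \<in> \<tau>" "t \<le> s"
      unfolding fmem_def by blast
    with r show "\<exists>r\<le>q. \<exists>s. (s, x) \<in> \<tau> \<and> r \<le> s"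
      using order_trans by blast
  qed
qed

lemma fmem_mono: "(x \<^bold>\<in> \<tau>) p \<Longrightarrow> q \<le> p \<Longrightarrow> (x \<^bold>\<in> \<tau>) q"
  by (rule regular_mono[OF regular_fmem])

lemma fimp_ground_iff:
  assumes "regular_sentence \<psi>"
  shows "(\<guillemotleft>b\<guillemotright> \<^bold>\<longrightarrow> \<psi>) p \<longleftrightarrow> (b \<longrightarrow> \<psi> p)"
proof -
  have "(\<guillemotleft>b\<guillemotright> \<^bold>\<longrightarrow> \<psi>) p \<longleftrightarrow> (\<forall>q\<le>p. b \<longrightarrow> \<psi> q)"
    by (simp add: fimp_iff fground_iff assms)
  also have "\<dots> \<longleftrightarrow> (b \<longrightarrow> \<psi> p)"
    using regular_mono[OF assms] by blast
  finally show ?thesis .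
qed

lemma fimp_ground_and_iff:
  assumes "regular_sentence \<phi>" "regular_sentence \<psi>"
  shows "(\<guillemotleft>b\<guillemotright> \<^bold>\<and> \<phi> \<^bold>\<longrightarrow> \<psi>) p \<longleftrightarrow> (b \<longrightarrow> (\<phi> \<^bold>\<longrightarrow> \<psi>) p)"
  using assms by (auto simp: fimp_iff fand_iff fground_iff)

lemma regular_fsubset [simp]: "regular_sentence (\<tau> \<^bold>\<subseteq> A)"
  by (simp add: fsubset_def)

lemma regular_feq [simp]: "regular_sentence (\<sigma> \<^bold>= \<tau>)"
  by (simp add: feq_def)

lemma fsubset_iff: "(\<tau> \<^bold>\<subseteq> A) p \<longleftrightarrow> (\<forall>q\<le>p. \<forall>x. (x \<^bold>\<in> \<tau>) q \<longrightarrow> x \<in> A)"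
  by (auto simp: fsubset_def fall_iff fimp_iff fground_iff)

lemma feq_iff: "(\<sigma> \<^bold>= \<tau>) p \<longleftrightarrow> (\<forall>q\<le>p. \<forall>x. (x \<^bold>\<in> \<sigma>) q \<longleftrightarrow> (x \<^bold>\<in> \<tau>) q)"
  by (auto simp: feq_def fall_iff fiff_def fand_iff fimp_iff)

lemma fmem_restrict: "(x \<^bold>\<in> \<tau> \<restriction> A) p \<longleftrightarrow> x \<in> A \<and> (x \<^bold>\<in> \<tau>) p"
  by (cases "x \<in> A") (auto simp: fmem_def name_restrict_def)

lemma fmem_at: "(x \<^bold>\<in> \<tau> \<^bold>! \<alpha>) p \<longleftrightarrow> ((\<alpha>, x) \<^bold>\<in> \<tau>) p"
  by (simp add: fmem_def name_at_def)

lemmas fsimps = fground_iff fand_iff fall_iff fex_iff fnot_fex_iff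
  fimp_ground_and_iff fimp_ground_iff fmem_restrict

lemmas regular_simps = regular_fground regular_fand regular_fall regular_fnot regular_fimp
  regular_fiff regular_fex regular_fmem regular_fsubset regular_feq

section \<open>Names defined by sentences, check names, and names decided by a condition\<close>

definition name_of :: "('x \<Rightarrow> 'p::order sentence) \<Rightarrow> ('p, 'x) name" where
  "name_of \<phi> = {(s, x). \<phi> x s}"

text \<open>Without regularity, membership is the closure of \<open>\<phi> x\<close> under density.
  This serves the names below that mention entries which a condition need not have yet.\<close>

lemma fmem_name_of_dense:
  assumes "\<And>p q. \<phi> x p \<Longrightarrow> q \<le> p \<Longrightarrow> \<phi> x q"
  shows "(x \<^bold>\<in> name_of \<phi>) p \<longleftrightarrow> (\<forall>q\<le>p. \<exists>r\<le>q. \<phi> x r)"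
  unfolding name_of_def fmem_def using assms by blast

lemma fmem_name_of:
  assumes "regular_sentence (\<phi> x)"
  shows "(x \<^bold>\<in> name_of \<phi>) p \<longleftrightarrow> \<phi> x p"
proof -
  have *: "(x \<^bold>\<in> name_of \<phi>) p \<longleftrightarrow> (\<forall>q\<le>p. \<exists>r\<le>q. \<phi> x r)"
    by (rule fmem_name_of_dense) (rule regular_mono[OF assms])
  show ?thesis
  proof
    assume "(x \<^bold>\<in> name_of \<phi>) p"
    then show "\<phi> x p"
      unfolding * by (intro regular_dense[OF assms]) blast
  next
    assume "\<phi> x p"
    then have "\<phi> x q" if "q \<le> p" for q
      using that by (rule regular_mono[OF assms])
    then show "(x \<^bold>\<in> name_of \<phi>) p"
      unfolding * by blast
  qed
qed

definition check :: "'x set \<Rightarrow> ('p::order, 'x) name" where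
  "check X = name_of (\<lambda>x. \<guillemotleft>x \<in> X\<guillemotright>)"

lemma fmem_check [simp]: "(x \<^bold>\<in> check X) p \<longleftrightarrow> x \<in> X"
  by (simp add: check_def fmem_name_of fground_iff)

text \<open>Quantifying over all \<open>q \<le> p\<close> makes \<open>p\<close> decide
  non-membership too: no extension adds an element.\<close>

definition evaluates :: "'p::order \<Rightarrow> ('p, 'x) name \<Rightarrow> 'x set \<Rightarrow> bool" where
  "evaluates p \<tau> X \<longleftrightarrow> (\<forall>q\<le>p. \<forall>x. (x \<^bold>\<in> \<tau>) q \<longleftrightarrow> x \<in> X)"

lemma evaluatesD: "evaluates p \<tau> X \<Longrightarrow> q \<le> p \<Longrightarrow> (x \<^bold>\<in> \<tau>) q \<longleftrightarrow> x \<in> X"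
  by (simp add: evaluates_def)

lemma evaluates_mono: "evaluates p \<tau> X \<Longrightarrow> q \<le> p \<Longrightarrow> evaluates q \<tau> X"
  unfolding evaluates_def using order_trans by blast

lemma evaluates_check: "evaluates p (check X) X"
  by (simp add: evaluates_def)

lemma evaluates_restrict: "evaluates p \<tau> X \<Longrightarrow> evaluates p (\<tau> \<restriction> A) (X \<inter> A)"
  by (auto simp: evaluates_def fmem_restrict)

lemma evaluates_unrestrict:
  assumes "evaluates p (\<tau> \<restriction> A) X" "(\<tau> \<^bold>\<subseteq> A) p"
  shows "evaluates p \<tau> X"
  using assms by (auto simp: evaluates_def fsubset_iff fmem_restrict)

lemma evaluates_feq: "evaluates p \<sigma> X \<Longrightarrow> evaluates p \<tau> Y \<Longrightarrow> (\<sigma> \<^bold>= \<tau>) p \<longleftrightarrow> X = Y"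
  by (auto simp: evaluates_def feq_iff)

section \<open>The notions of the extension as statements about conditions\<close>

lemma regular_function_G [simp]: "regular_sentence (function_G A B F)"
  by (simp add: function_G_def)

lemma regular_uncountable_G [simp]: "regular_sentence (uncountable_G A)"
  by (simp add: uncountable_G_def)

lemma regular_inaccessible_G [simp]: "regular_sentence (inaccessible_G A)"
  by (simp add: inaccessible_G_def)

lemma regular_club_G [simp]: "regular_sentence (club_G A C)"
  by (simp add: club_G_def)

lemma regular_stationary_G [simp]: "regular_sentence (stationary_G A C)"
  by (simp add: stationary_G_def)

lemma regular_one_club_G [simp]: "regular_sentence (one_club_G A C)"
  by (simp add: one_club_G_def)

lemma function_G_iff:
  "function_G A B F p \<longleftrightarrow> (\<forall>q\<le>p. \<forall>x y. ((x, y) \<^bold>\<in> F) q \<longrightarrow> x \<in> A \<and> y \<in> B) \<and>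
     (\<forall>x\<in>A. \<forall>q\<le>p. \<exists>y. \<exists>r\<le>q. ((x, y) \<^bold>\<in> F) r) \<and>
     (\<forall>x y z. \<forall>q\<le>p. ((x, y) \<^bold>\<in> F) q \<and> ((x, z) \<^bold>\<in> F) q \<longrightarrow> y = z)"
  unfolding function_G_def
  \<comment> \<open>Implications with a ground model antecedent are unfolded first, without passing
    to extensions; the remaining ones go through \<open>fimp_iff\<close>, whose premises
    \<open>regular_simps\<close> discharges.\<close>
  by (simp add: fsimps fsubset_iff,
      simp only: fimp_iff regular_simps,
      simp add: fsimps fsubset_iff Ball_def)

lemma club_G_iff:
  "club_G A C p \<longleftrightarrow> (\<forall>q\<le>p. \<forall>x. (x \<^bold>\<in> C) q \<longrightarrow> x \<in> A) \<and>
     (\<forall>x\<in>A. \<forall>q\<le>p. \<exists>y. \<exists>r\<le>q. (y \<^bold>\<in> C) r \<and> x \<le> y) \<and>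
     (\<forall>\<delta>\<in>A. (\<exists>x. x < \<delta>) \<longrightarrow> (\<forall>q\<le>p.
        (\<forall>x<\<delta>. \<forall>r\<le>q. \<exists>y. \<exists>s\<le>r. (y \<^bold>\<in> C) s \<and> x < y \<and> y < \<delta>) \<longrightarrow> (\<delta> \<^bold>\<in> C) q))"
  unfolding club_G_def
  by (simp add: fsimps fsubset_iff,
      simp only: fimp_iff regular_simps,
      simp add: fsimps fsubset_iff Ball_def)

lemma stationary_G_iff:
  "stationary_G A S p \<longleftrightarrow> (\<forall>q\<le>p. \<forall>x. (x \<^bold>\<in> S) q \<longrightarrow> x \<in> A) \<and>
     (\<forall>C. \<forall>q\<le>p. club_G A C q \<longrightarrow> (\<forall>r\<le>q. \<exists>x. \<exists>s\<le>r. (x \<^bold>\<in> C) s \<and> (x \<^bold>\<in> S) s))"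
  unfolding stationary_G_def
  by (simp add: fsimps fsubset_iff,
      simp only: fimp_iff regular_simps regular_club_G,
      simp add: fsimps Ball_def)

lemma one_club_G_iff:
  "one_club_G A C p \<longleftrightarrow> stationary_G A C p \<and>
     (\<forall>\<beta>\<in>A. \<forall>q\<le>p. inaccessible_G {..<\<beta>} q \<and> stationary_G {..<\<beta>} (C \<restriction> {..<\<beta>}) q \<longrightarrow> (\<beta> \<^bold>\<in> C) q)"
  unfolding one_club_G_def
  by (simp add: fsimps fsubset_iff,
      simp only: fimp_iff regular_simps regular_stationary_G regular_inaccessible_G,
      simp add: fsimps Ball_def)

lemma uncountable_G_iff:
  "uncountable_G A p \<longleftrightarrow> (\<forall>F. \<forall>q\<le>p. function_G A UNIV F q \<longrightarrow>
     \<not> (\<forall>x y. \<forall>n::nat. \<forall>r\<le>q. ((x, n) \<^bold>\<in> F) r \<and> ((y, n) \<^bold>\<in> F) r \<longrightarrow> x = y))"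
  unfolding uncountable_G_def
  by (simp add: fsimps fsubset_iff,
      simp only: fimp_iff regular_simps,
      simp add: fsimps fsubset_iff Ball_def)

lemma inaccessible_G_iff:
  "inaccessible_G A p \<longleftrightarrow> uncountable_G A p \<and>
     (\<forall>\<beta>\<in>A. \<forall>F :: (_, _ \<times> _) name. \<forall>q\<le>p. function_G {..<\<beta>} A F q \<longrightarrow>
        (\<forall>r\<le>q. \<not> (\<forall>x\<in>A. \<forall>s\<le>r. \<exists>\<xi> y. \<exists>t\<le>s. ((\<xi>, y) \<^bold>\<in> F) t \<and> x \<le> y))) \<and>
     (\<forall>\<beta>\<in>A. \<forall>R. \<forall>q\<le>p. (R \<^bold>\<subseteq> A \<times> {..<\<beta>}) q \<longrightarrow>
        \<not> (\<forall>\<xi> \<eta>. \<xi> \<in> A \<and> \<eta> \<in> A \<longrightarrow> (\<forall>r\<le>q. (R \<^bold>! \<xi> \<^bold>= R \<^bold>! \<eta>) r \<longrightarrow> \<xi> = \<eta>)))"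
  unfolding inaccessible_G_def
  by (simp add: fsimps,
      simp only: fimp_iff regular_simps regular_function_G,
      simp add: fnot_iff fex_fex_iff fsimps Ball_def Bex_def del: fex_iff)

section \<open>Inaccessible cardinals and stationary sets\<close>

lemma well_order_on_le: "well_order_on UNIV {(x, y :: 'k::wellorder). x \<le> y}"
proof -
  have "{(x, y :: 'k). x \<le> y} - Id = {(x, y). x < y}"
    by auto
  then have "wf ({(x, y :: 'k). x \<le> y} - Id)"
    by (simp only: wf)
  moreover have "linear_order_on UNIV {(x, y :: 'k). x \<le> y}"
    unfolding linear_order_on_def partial_order_on_def preorder_on_def
    by (intro conjI refl_onI transI antisymI) (auto simp: total_on_def)
  ultimately show ?thesis
    by (simp add: well_order_on_def)
qed

text \<open>The cardinal of \<open>I\<close> is less than the order type of \<open>'k\<close>, hence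
  isomorphic to a proper initial segment. Recursions along \<open>I\<close> can therefore run along
  ordinals below some \<open>l\<close>.\<close>

lemma bij_initial_segment:
  assumes "I \<prec> (UNIV :: 'k::wellorder set)"
  obtains l :: "'k::wellorder" and h where "bij_betw h {..<l} I"
proof -
  let ?r = "{(x, y :: 'k). x \<le> y}"
  have r: "well_order_on UNIV ?r" and F: "Field ?r = UNIV"
    using well_order_on_le by (auto simp: Field_def)
  have "\<not> (UNIV :: 'k set) \<lesssim> I"
    using assms lepoll_antisym unfolding lesspoll_def by blast
  then have "ordLess2 (card_of I) (card_of (UNIV :: 'k set))"
    by (simp add: lepoll_def flip: card_of_ordLess)
  moreover have "ordLeq2 (card_of (UNIV :: 'k set)) ?r"
    using card_of_least[OF r] .
  ultimately have "ordLess2 (card_of I) ?r"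
    by (rule ordLess_ordLeq_trans)
  moreover have "Well_order ?r"
    using r unfolding F .
  ultimately obtain a where a: "ordIso2 (card_of I) (Restr ?r (underS ?r a))"
    using ordLess_iff_ordIso_Restr[of ?r "card_of I"] card_of_Well_order by blast
  have "underS ?r a = {..<a}"
    by (auto simp: underS_def)
  then have "Field (Restr ?r (underS ?r a)) = {..<a}"
    by (auto simp: Field_def)
  then have "ordIso2 (card_of I) (card_of {..<a})"
    using card_of_cong[OF a] by (simp add: Field_card_of)
  then have "{..<a} \<approx> I"
    by (simp add: eqpoll_iff_card_of_ordIso[symmetric] eqpoll_sym)
  then show thesis
    using that unfolding eqpoll_def by blast
qed

lemma inaccessible_Pow_lesspoll: "inaccessible A \<Longrightarrow> \<beta> \<in> A \<Longrightarrow> Pow {..<\<beta>} \<prec> A"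
  by (simp add: inaccessible_def)

lemma inaccessible_lesspoll: "inaccessible A \<Longrightarrow> \<beta> \<in> A \<Longrightarrow> {..<\<beta>} \<prec> A"
  using inaccessible_Pow_lesspoll lepoll_Pow_self lesspoll_trans1 by blast

lemma inaccessible_nat_lesspoll:
  assumes "inaccessible A" shows "(UNIV :: nat set) \<prec> A"
proof -
  have "uncountable A"
    using assms by (simp add: inaccessible_def)
  then show ?thesis
    by (metis countable_def countable_finite eqpoll_imp_lepoll eqpoll_sym infinite_le_lepoll
        lepoll_def lesspoll_def top_greatest)
qed

lemma lesspoll_UNIV: "I \<prec> (A :: 'k set) \<Longrightarrow> I \<prec> (UNIV :: 'k set)"
  by (erule lesspoll_trans2) (rule subset_imp_lepoll[OF subset_UNIV])

lemma inaccessible_regular: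
  assumes "inaccessible A" "\<beta> \<in> A" "f ` {..<\<beta>} \<subseteq> A"
  shows "\<exists>x\<in>A. \<forall>\<xi><\<beta>. f \<xi> < x"
proof -
  have "\<not> (\<forall>x\<in>A. \<exists>\<xi><\<beta>. x \<le> f \<xi>)"
    using assms by (simp add: inaccessible_def)
  then show ?thesis
    by (auto simp: not_le)
qed

lemma inaccessible_limit:
  assumes "inaccessible A" "x \<in> A"
  shows "\<exists>y\<in>A. x < y"
proof (cases "\<exists>\<xi>. \<xi> < x")
  \<comment> \<open>Regularity strictly bounds the constant function with value \<open>x\<close> on
    \<open>{..<x}\<close>. For the least element this function is empty, and uncountability of
    \<open>A\<close> is used instead.\<close>
  case True
  then show ?thesis
    using inaccessible_regular[OF assms, of "\<lambda>_. x"] assms(2) by auto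
next
  case False
  have "\<not> A \<subseteq> {x}"
    using assms(1) countable_subset[of A "{x}"] by (auto simp: inaccessible_def)
  then obtain y where "y \<in> A" "y \<noteq> x"
    by blast
  with False show ?thesis
    by (auto simp: neq_iff)
qed

section \<open>Clubs and stationary sets in an inaccessible\<close>

lemma club_tail:
  assumes "inaccessible A" "club A C" "b \<in> A"
  shows "club A (C \<inter> {b<..})"
  unfolding club_def
proof (intro conjI ballI impI)
  show "C \<inter> {b<..} \<subseteq> A"
    using assms(2) by (auto simp: club_def)
  fix x assume "x \<in> A"
  then have "max x b \<in> A"
    using assms(3) by (simp add: max_def)
  then obtain y where "y \<in> A" "max x b < y"
    using inaccessible_limit[OF assms(1)] by blast
  then obtain c where "c \<in> C" "max x b < c"
    using assms(2) less_le_trans unfolding club_def by blast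
  then show "\<exists>y\<in>C \<inter> {b<..}. x \<le> y"
    by (intro bexI[of _ c]) auto
next
  fix \<delta> assume \<delta>: "\<delta> \<in> A" and *: "(\<exists>x. x < \<delta>) \<and> (\<forall>x<\<delta>. \<exists>y\<in>C \<inter> {b<..}. x < y \<and> y < \<delta>)"
  then have "b < \<delta>"
    by (auto dest: less_trans)
  moreover have "\<delta> \<in> C"
    using * \<delta> assms(2) unfolding club_def by blast
  ultimately show "\<delta> \<in> C \<inter> {b<..}"
    by simp
qed

lemma club_self: "club A A"
  by (auto simp: club_def)

lemma stationary_self:
  assumes "inaccessible A" shows "stationary A A"
proof -
  have "A \<noteq> {}"
    using assms by (auto simp: inaccessible_def)
  then show ?thesis
    unfolding stationary_def club_def by blast
qed

lemma stationary_tail: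
  assumes "inaccessible A" "stationary A S" "b \<in> A"
  shows "stationary A (S \<inter> {b<..})"
  using assms(2) club_tail[OF assms(1) _ assms(3)] unfolding stationary_def by blast

lemma stationary_unbounded:
  assumes "inaccessible A" "stationary A S" "b \<in> A"
  shows "\<exists>s\<in>S. b < s"
  using stationary_tail[OF assms] club_self[of A] unfolding stationary_def by blast

lemma stationary_mono: "stationary A S \<Longrightarrow> S \<subseteq> T \<Longrightarrow> T \<subseteq> A \<Longrightarrow> stationary A T"
  unfolding stationary_def by blast

text \<open>Stationary sets are unbounded. Coherence in \<open>is_condition\<close> ranges over all
  pairs of indices, and this reduces it to \<alpha> \<le> \<beta>.\<close>

lemma stationary_restrict_le:
  assumes "inaccessible {..<\<alpha>}" "stationary {..<\<alpha>} (S \<inter> {..<\<alpha>})" "S \<subseteq> {..<\<beta>}"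
  shows "\<alpha> \<le> (\<beta> :: 'k::wellorder)"
proof (rule ccontr)
  assume "\<not> \<alpha> \<le> \<beta>"
  then obtain s where "s \<in> S" "\<beta> < s"
    using stationary_unbounded[OF assms(1,2), of \<beta>] by (auto simp: not_le)
  with assms(3) show False
    by auto
qed

section \<open>Conditions\<close>

lemma is_condition_Rep: "is_condition (Rep_Q q)"
  using Rep_Q[of q] by simp

lemma Rep_Q_Abs_Q: "is_condition m \<Longrightarrow> Rep_Q (Abs_Q m) = m"
  by (simp add: Abs_Q_inverse)

text \<open>A relation and not a function: ordinals with the same inaccessibles up to them are
  lengths of the same condition.\<close>

definition has_length :: "'k::wellorder Q \<Rightarrow> 'k \<Rightarrow> bool" where
  "has_length q \<gamma> \<longleftrightarrow> dom (Rep_Q q) = inacc \<inter> {..\<gamma>}"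

lemma has_length_exists: "\<exists>\<gamma>. has_length q \<gamma>"
  using is_condition_Rep[of q] by (auto simp: is_condition_def has_length_def)

text \<open>Domains are initial segments of the inaccessibles, so extending the map already means
  end-extending it.\<close>

lemma le_Q_iff: "p \<le> q \<longleftrightarrow> Rep_Q q \<subseteq>\<^sub>m Rep_Q p"
proof -
  obtain \<gamma> \<delta> where "has_length p \<gamma>" "has_length q \<delta>"
    using has_length_exists by blast
  then show ?thesis
    by (auto simp: less_eq_Q_def end_extends_def has_length_def)
qed

lemma has_length_le:
  assumes "has_length q \<gamma>" "r \<le> q"
  obtains \<delta> where "\<gamma> \<le> \<delta>" "has_length r \<delta>"
proof -
  obtain \<delta> where \<delta>: "has_length r \<delta>"
    using has_length_exists by blast
  have "dom (Rep_Q q) \<subseteq> dom (Rep_Q r)"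
    using assms(2) by (simp add: le_Q_iff map_le_implies_dom_le)
  \<comment> \<open>If \<gamma> exceeds \<delta>, there are no inaccessibles above \<delta> and up
    to \<gamma>, so \<gamma> is a length of \<open>r\<close> as well.\<close>
  then have "has_length r (max \<gamma> \<delta>)"
    using assms(1) \<delta> unfolding has_length_def by (auto simp: max_def)
  then show thesis
    using that[of "max \<gamma> \<delta>"] by simp
qed

lemma inacc_iff: "\<alpha> \<in> inacc \<longleftrightarrow> inaccessible {..<\<alpha>}"
  by (simp add: inacc_def)

lemma Rep_Q_le: "r \<le> q \<Longrightarrow> \<alpha> \<in> dom (Rep_Q q) \<Longrightarrow> Rep_Q r \<alpha> = Rep_Q q \<alpha>"
  by (auto simp: le_Q_iff map_le_def)

lemma one_club_Rep: "\<alpha> \<in> dom (Rep_Q q) \<Longrightarrow> one_club {..<\<alpha>} (the (Rep_Q q \<alpha>))"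
  using is_condition_Rep[of q] by (simp add: is_condition_def)

lemma subset_Rep: "\<alpha> \<in> dom (Rep_Q q) \<Longrightarrow> the (Rep_Q q \<alpha>) \<subseteq> {..<\<alpha>}"
  using one_club_Rep unfolding one_club_def stationary_def by blast

lemma coherent_Rep:
  assumes "\<alpha> \<in> dom (Rep_Q q)" "\<beta> \<in> dom (Rep_Q q)"
    and "stationary {..<\<alpha>} (the (Rep_Q q \<beta>) \<inter> {..<\<alpha>})"
  shows "the (Rep_Q q \<alpha>) = the (Rep_Q q \<beta>) \<inter> {..<\<alpha>}"
  using is_condition_Rep[of q] assms unfolding is_condition_def by blast

lemma dom_Rep_inacc: "\<alpha> \<in> dom (Rep_Q q) \<Longrightarrow> inaccessible {..<\<alpha>}"
  using has_length_exists[of q] by (auto simp: has_length_def inacc_iff)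

text \<open>Fill the new places with the final segments \<open>{\<gamma>q<..<\<alpha>}\<close>. They
  are 1-clubs that cohere with each other, and as they start above the old length, their traces on
  old indices are empty and hence not stationary.\<close>

lemma extend_length: "\<exists>r\<le>q. \<exists>\<delta>\<ge>\<gamma>. has_length r \<delta>"
proof -
  obtain \<gamma>q where q: "has_length q \<gamma>q"
    using has_length_exists by blast
  show ?thesis
  proof (cases "\<gamma> \<le> \<gamma>q")
    case True
    with q show ?thesis by blast
  next
    case False
    define m where "m \<alpha> = (if \<alpha> \<in> inacc \<inter> {..\<gamma>} then
      (if \<alpha> \<le> \<gamma>q then Rep_Q q \<alpha> else Some {\<gamma>q<..<\<alpha>}) else None)" for \<alpha>
    have dq: "\<alpha> \<in> dom (Rep_Q q)" if "\<alpha> \<in> inacc" "\<alpha> \<le> \<gamma>q" for \<alpha>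
      using q that by (simp add: has_length_def)
    have m_old: "m \<alpha> = Rep_Q q \<alpha>" if "\<alpha> \<in> inacc" "\<alpha> \<le> \<gamma>q" for \<alpha>
      using that False by (auto simp: m_def)
    have m_new: "the (m \<alpha>) = {\<gamma>q<..<\<alpha>}" if "\<alpha> \<in> inacc \<inter> {..\<gamma>}" "\<not> \<alpha> \<le> \<gamma>q" for \<alpha>
      using that by (simp add: m_def)
    have dom: "dom m = inacc \<inter> {..\<gamma>}"
    proof -
      have "m \<alpha> \<noteq> None" if "\<alpha> \<in> inacc \<inter> {..\<gamma>}" for \<alpha>
        using that dq[of \<alpha>] by (auto simp: m_def)
      then show ?thesis by (auto simp: m_def split: if_splits)
    qed
    have "is_condition m"
      unfolding is_condition_def
    proof (intro conjI ballI impI)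
      show "\<exists>\<gamma>. dom m = inacc \<inter> {..\<gamma>}" using dom by blast
    next
      fix \<alpha> assume "\<alpha> \<in> dom m"
      then have \<alpha>: "\<alpha> \<in> inacc" "\<alpha> \<le> \<gamma>" by (auto simp: dom)
      show "one_club {..<\<alpha>} (the (m \<alpha>))"
      proof (cases "\<alpha> \<le> \<gamma>q")
        case True
        then show ?thesis using \<alpha> one_club_Rep[OF dq] by (simp add: m_old)
      next
        case False
        have i: "inaccessible {..<\<alpha>}" using \<alpha> by (simp add: inacc_iff)
        have "stationary {..<\<alpha>} ({..<\<alpha>} \<inter> {\<gamma>q<..})"
          by (rule stationary_tail[OF i stationary_self[OF i]]) (use False in auto)
        moreover have "{..<\<alpha>} \<inter> {\<gamma>q<..} = {\<gamma>q<..<\<alpha>}" by auto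
        moreover have "\<beta> \<in> {\<gamma>q<..<\<alpha>}" if "\<beta> < \<alpha>" and st: "stationary {..<\<beta>} ({\<gamma>q<..<\<alpha>} \<inter> {..<\<beta>})" for \<beta>
        proof -
          obtain x where "x \<in> {\<gamma>q<..<\<alpha>} \<inter> {..<\<beta>}"
            using st club_self unfolding stationary_def by blast
          with \<open>\<beta> < \<alpha>\<close> show ?thesis by auto
        qed
        ultimately show ?thesis
          using m_new[of \<alpha>] \<alpha> False by (simp add: one_club_def)
      qed
    next
      fix \<alpha> \<beta> assume "\<alpha> \<in> dom m" "\<beta> \<in> dom m"
      then have ab: "\<alpha> \<in> inacc" "\<alpha> \<le> \<gamma>" "\<beta> \<in> inacc" "\<beta> \<le> \<gamma>" by (auto simp: dom)
      assume st: "stationary {..<\<alpha>} (the (m \<beta>) \<inter> {..<\<alpha>})"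
      have i: "inaccessible {..<\<alpha>}" using ab by (simp add: inacc_iff)
      have "the (m \<beta>) \<subseteq> {..<\<beta>}"
        using ab subset_Rep[OF dq] m_old m_new[of \<beta>] by (cases "\<beta> \<le> \<gamma>q") auto
      from stationary_restrict_le[OF i st this] have le: "\<alpha> \<le> \<beta>" .
      show "the (m \<alpha>) = the (m \<beta>) \<inter> {..<\<alpha>}"
      proof (cases "\<beta> \<le> \<gamma>q")
        case True
        with le have "\<alpha> \<le> \<gamma>q" by simp
        have "m \<alpha> = Rep_Q q \<alpha>" "m \<beta> = Rep_Q q \<beta>"
          using ab True \<open>\<alpha> \<le> \<gamma>q\<close> by (simp_all only: m_old)
        with st show ?thesis
          using coherent_Rep[OF dq[OF ab(1) \<open>\<alpha> \<le> \<gamma>q\<close>] dq[OF ab(3) True]] by simp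
      next
        case False
        with ab have mb: "the (m \<beta>) = {\<gamma>q<..<\<beta>}" by (simp add: m_new)
        obtain x where "x \<in> the (m \<beta>) \<inter> {..<\<alpha>}"
          using st club_self unfolding stationary_def by blast
        then have "\<not> \<alpha> \<le> \<gamma>q" by (auto simp: mb)
        with ab mb le show ?thesis by (auto simp: m_new)
      qed
    qed
    note R = Rep_Q_Abs_Q[OF this]
    have "Abs_Q m \<le> q"
      unfolding le_Q_iff R map_le_def
      using q m_old by (auto simp: has_length_def)
    moreover have "has_length (Abs_Q m) \<gamma>"
      by (simp add: has_length_def R dom)
    ultimately show ?thesis by blast
  qed
qed

text \<open>
  As \<open>l \<le> g i\<close>, a supremum of the lengths that is not attained has cofinality at most \<open>l\<close> and is
  singular; thus no new entry is needed there.
\<close>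

lemma chain_union:
  fixes f :: "'i \<Rightarrow> 'k::wellorder Q" and l :: 'k
  assumes inac: "inaccessible (UNIV :: 'k set)"
    and I: "I = h ` {..<l}" "I \<noteq> {}"
    and len: "\<And>i. i \<in> I \<Longrightarrow> has_length (f i) (g i)" "\<And>i. i \<in> I \<Longrightarrow> l \<le> g i"
    and chain: "\<And>i j. i \<in> I \<Longrightarrow> j \<in> I \<Longrightarrow> f i \<le> f j \<or> f j \<le> f i"
  obtains u \<delta> where "has_length u \<delta>" "\<And>i. i \<in> I \<Longrightarrow> u \<le> f i" "\<And>i. i \<in> I \<Longrightarrow> g i \<le> \<delta>"
    "\<And>x. x < \<delta> \<Longrightarrow> \<exists>i\<in>I. x < g i"
proof -
  obtain b where "\<forall>\<xi><l. (g \<circ> h) \<xi> < b"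
    using inaccessible_regular[OF inac, of l "g \<circ> h"] by auto
  then have b: "\<forall>i\<in>I. g i \<le> b"
    unfolding I by auto
  \<comment> \<open>The supremum of the lengths, which exists because regularity of \<kappa>
    provides the bound \<open>b\<close>.\<close>
  define \<delta> where "\<delta> = (LEAST d. \<forall>i\<in>I. g i \<le> d)"
  have ub: "\<forall>i\<in>I. g i \<le> \<delta>"
    unfolding \<delta>_def using b by (rule LeastI)
  have lub: "\<exists>i\<in>I. x < g i" if "x < \<delta>" for x
    using not_less_Least[OF that[unfolded \<delta>_def]] by (auto simp: not_le)
  \<comment> \<open>The union of the chain. \<open>SOME\<close> picks any member defined at
    \<alpha>; comparability makes the choice irrelevant.\<close>
  define m where "m \<alpha> = (if \<exists>i\<in>I. \<alpha> \<in> dom (Rep_Q (f i))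
    then Rep_Q (f (SOME i. i \<in> I \<and> \<alpha> \<in> dom (Rep_Q (f i)))) \<alpha> else None)" for \<alpha>
  have m: "m \<alpha> = Rep_Q (f i) \<alpha>" if "i \<in> I" "\<alpha> \<in> dom (Rep_Q (f i))" for i \<alpha>
  proof -
    let ?j = "SOME i. i \<in> I \<and> \<alpha> \<in> dom (Rep_Q (f i))"
    have j: "?j \<in> I \<and> \<alpha> \<in> dom (Rep_Q (f ?j))"
      by (rule someI[of _ i]) (use that in simp)
    then have "f ?j \<le> f i \<or> f i \<le> f ?j"
      using chain that by blast
    then have "Rep_Q (f ?j) \<alpha> = Rep_Q (f i) \<alpha>"
      using Rep_Q_le[of "f ?j" "f i" \<alpha>] Rep_Q_le[of "f i" "f ?j" \<alpha>] j that by argo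
    moreover have "\<exists>i\<in>I. \<alpha> \<in> dom (Rep_Q (f i))"
      using that by blast
    ultimately show ?thesis
      by (simp only: m_def if_True)
  qed
  have dom_iff: "\<alpha> \<in> dom m \<longleftrightarrow> (\<exists>i\<in>I. \<alpha> \<in> dom (Rep_Q (f i)))" for \<alpha>
  proof
    assume "\<alpha> \<in> dom m"
    then show "\<exists>i\<in>I. \<alpha> \<in> dom (Rep_Q (f i))"
      by (rule contrapos_pp) (simp add: m_def domIff)
  next
    assume "\<exists>i\<in>I. \<alpha> \<in> dom (Rep_Q (f i))"
    then obtain i where "i \<in> I" "\<alpha> \<in> dom (Rep_Q (f i))"
      by blast
    with m[OF this] show "\<alpha> \<in> dom m"
      by (simp add: domIff)
  qed
  have dom_f: "dom (Rep_Q (f i)) = inacc \<inter> {..g i}" if "i \<in> I" for i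
    using len(1)[OF that] by (simp add: has_length_def)
  have dom: "dom m = inacc \<inter> {..\<delta>}"
  proof (intro set_eqI iffI)
    fix \<alpha> assume "\<alpha> \<in> dom m"
    then obtain i where "i \<in> I" "\<alpha> \<in> inacc \<inter> {..g i}"
      unfolding dom_iff using dom_f by blast
    then show "\<alpha> \<in> inacc \<inter> {..\<delta>}"
      using ub order_trans by auto
  next
    fix \<alpha> assume \<alpha>: "\<alpha> \<in> inacc \<inter> {..\<delta>}"
    have "\<exists>i\<in>I. \<alpha> \<le> g i"
    proof (rule ccontr)
      assume neg: "\<not> (\<exists>i\<in>I. \<alpha> \<le> g i)"
      with \<alpha> lub have "\<alpha> = \<delta>" 
        by (metis IntD2 antisym_conv2 atMost_iff less_imp_le)
      with \<alpha> have i: "inaccessible {..<\<delta>}" by (simp add: inacc_iff)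
      from neg \<open>\<alpha> = \<delta>\<close> have lt: "g i < \<delta>" if "i \<in> I" for i
        using that by (auto simp: not_le)
      then have "l < \<delta>"
        using I(2) len(2) le_less_trans by blast
      moreover have "(g \<circ> h) ` {..<l} \<subseteq> {..<\<delta>}"
        using lt unfolding I by auto
      ultimately obtain x where "x < \<delta>" "\<forall>\<xi><l. g (h \<xi>) < x"
        using inaccessible_regular[OF i, of l "g \<circ> h"] by auto
      with lub[of x] show False
        unfolding I by auto
    qed
    then show "\<alpha> \<in> dom m"
      using \<alpha> dom_f unfolding dom_iff by blast
  qed
  have "is_condition m"
    unfolding is_condition_def
  proof (intro conjI ballI impI)
    show "\<exists>\<gamma>. dom m = inacc \<inter> {..\<gamma>}" using dom by blast
  next
    fix \<alpha> assume "\<alpha> \<in> dom m"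
    then obtain i where i: "i \<in> I" "\<alpha> \<in> dom (Rep_Q (f i))"
      unfolding dom_iff by blast
    then show "one_club {..<\<alpha>} (the (m \<alpha>))"
      using one_club_Rep[OF i(2)] m[OF i] by simp
  next
    fix \<alpha> \<beta> assume "\<alpha> \<in> dom m" "\<beta> \<in> dom m"
    then obtain i j where ij: "i \<in> I" "\<alpha> \<in> dom (Rep_Q (f i))" "j \<in> I" "\<beta> \<in> dom (Rep_Q (f j))"
      unfolding dom_iff by blast
    \<comment> \<open>Of two comparable members one is defined at both indices, and its own
      coherence applies.\<close>
    have "dom (Rep_Q (f i)) \<subseteq> dom (Rep_Q (f j)) \<or> dom (Rep_Q (f j)) \<subseteq> dom (Rep_Q (f i))"
      using chain[OF ij(1,3)] map_le_implies_dom_le unfolding le_Q_iff by blast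
    then obtain k where k: "k \<in> I" "\<alpha> \<in> dom (Rep_Q (f k))" "\<beta> \<in> dom (Rep_Q (f k))"
      using ij by blast
    assume "stationary {..<\<alpha>} (the (m \<beta>) \<inter> {..<\<alpha>})"
    then show "the (m \<alpha>) = the (m \<beta>) \<inter> {..<\<alpha>}"
      using coherent_Rep[OF k(2,3)] m[OF k(1,2)] m[OF k(1,3)] by simp
  qed
  note R = Rep_Q_Abs_Q[OF this]
  show thesis
  proof (rule that)
    show "has_length (Abs_Q m) \<delta>"
      by (simp add: has_length_def R dom)
    show "Abs_Q m \<le> f i" if "i \<in> I" for i
      unfolding le_Q_iff R map_le_def using m that by auto
  qed (use ub lub in auto)
qed

text \<open>Fewer than \<kappa> open dense sets have a common member below any condition: meet them
  one after the other along a descending sequence of length \<open>l\<close>, with lower bounds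
  supplied by \<open>chain_union\<close>.\<close>

lemma Q_distributive:
  fixes q :: "'k::wellorder Q"
  assumes inac: "inaccessible (UNIV :: 'k set)" and I: "I \<prec> (UNIV :: 'k set)"
    and dense: "\<And>i r. i \<in> I \<Longrightarrow> r \<le> q \<Longrightarrow> \<exists>s\<le>r. P i s"
    and mono: "\<And>i r s. i \<in> I \<Longrightarrow> P i r \<Longrightarrow> s \<le> r \<Longrightarrow> P i s"
  shows "\<exists>r\<le>q. \<forall>i\<in>I. P i r"
proof (cases "I = {}")
  case True
  then show ?thesis by blast
next
  case False
  obtain l :: 'k and h where h: "bij_betw h {..<l} I"
    using bij_initial_segment[OF I] .
  \<comment> \<open>Beginning with length at least \<open>l\<close> ensures that all later members
    are long enough for \<open>chain_union\<close>.\<close>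
  obtain q0 \<gamma>0 where q0: "q0 \<le> q" "l \<le> \<gamma>0" "has_length q0 \<gamma>0"
    using extend_length by blast
  \<comment> \<open>A stage is a condition together with one of its lengths. The recursion runs over
    all of \<open>'k\<close>, so stages from \<open>l\<close> on are left arbitrary.\<close>
  define T where "T f x r \<longleftrightarrow> (x < l \<longrightarrow> fst r \<le> q0 \<and> has_length (fst r) (snd r) \<and> l \<le> snd r \<and>
    P (h x) (fst r) \<and> (\<forall>y<x. fst r \<le> fst (f y)))"
    for f :: "'k \<Rightarrow> 'k Q \<times> 'k" and x r
  have "\<exists>f. \<forall>x. T f x (f x)"
  proof (rule dependent_wellorder_choice)
    show "T f x r = T g x r" if "\<And>y. y < x \<Longrightarrow> f y = g y" for f g x r
      using that by (simp add: T_def)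
  next
    fix x f assume IH: "\<And>y. y < x \<Longrightarrow> T f y (f y)"
    show "\<exists>r. T f x r"
    proof (cases "x < l")
      case False
      then show ?thesis by (simp add: T_def)
    next
      case True
      have IH': "fst (f y) \<le> q0" "has_length (fst (f y)) (snd (f y))" "l \<le> snd (f y)"
        "\<forall>z<y. fst (f y) \<le> fst (f z)" if "y < x" for y
        using IH[OF that] True that by (auto simp: T_def)
      \<comment> \<open>The earlier stages are bounded by their union, taken with \<open>x\<close>
        as the index ordinal; at the first stage \<open>q0\<close> serves.\<close>
      have "\<exists>u. u \<le> q0 \<and> (\<forall>y<x. u \<le> fst (f y))"
      proof (cases "{..<x} = {}")
        case True
        then show ?thesis by (intro exI[of _ q0]) auto
      next
        case False
        obtain u \<delta> where "\<And>y. y \<in> {..<x} \<Longrightarrow> u \<le> fst (f y)"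
        proof (rule chain_union[OF inac, of "{..<x}" id x "\<lambda>y. fst (f y)" "\<lambda>y. snd (f y)"])
          show "x \<le> snd (f i)" if "i \<in> {..<x}" for i
            using that IH'(3)[of i] True by simp
          show "fst (f i) \<le> fst (f j) \<or> fst (f j) \<le> fst (f i)" if "i \<in> {..<x}" "j \<in> {..<x}" for i j
            using that IH'(4)[of i] IH'(4)[of j] by (cases i j rule: linorder_cases) auto
        qed (use False IH' in auto)
        moreover obtain y where "y < x" using False by auto
        ultimately have "u \<le> q0" using IH'(1) by (meson lessThan_iff order_trans)
        with \<open>\<And>y. y \<in> {..<x} \<Longrightarrow> u \<le> fst (f y)\<close> show ?thesis by auto
      qed
      then obtain u where u: "u \<le> q0" "\<forall>y<x. u \<le> fst (f y)" by blast
      have "h x \<in> I" using h True by (auto simp: bij_betw_def)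
      then obtain s where s: "s \<le> u" "P (h x) s"
        using dense[of "h x" u] u(1) q0(1) by (meson order_trans)
      obtain \<delta> where \<delta>: "\<gamma>0 \<le> \<delta>" "has_length s \<delta>"
        using has_length_le[OF q0(3) order_trans[OF s(1) u(1)]] .
      have "T f x (s, \<delta>)"
        using s u(2) \<delta>(2) order_trans[OF s(1) u(1)] order_trans[OF q0(2) \<delta>(1)]
          order_trans[OF s(1)] by (simp add: T_def)
      then show ?thesis ..
    qed
  qed
  then obtain f where f: "\<And>x. T f x (f x)" by blast
  then have f': "fst (f y) \<le> q0" "has_length (fst (f y)) (snd (f y))" "l \<le> snd (f y)"
    "P (h y) (fst (f y))" "\<forall>z<y. fst (f y) \<le> fst (f z)" if "y < l" for y
    using f[of y] that by (auto simp: T_def)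
  have ne: "{..<l} \<noteq> {}" using False h by (auto simp: bij_betw_def)
  obtain u \<delta> where u: "\<And>y. y \<in> {..<l} \<Longrightarrow> u \<le> fst (f y)"
  proof (rule chain_union[OF inac, of "{..<l}" id l "\<lambda>y. fst (f y)" "\<lambda>y. snd (f y)"])
    show "fst (f i) \<le> fst (f j) \<or> fst (f j) \<le> fst (f i)" if "i \<in> {..<l}" "j \<in> {..<l}" for i j
      using that f'(5)[of i] f'(5)[of j] by (cases i j rule: linorder_cases) auto
  qed (use ne f' in auto)
  have "P i u" if "i \<in> I" for i
  proof -
    obtain y where y: "y < l" "i = h y"
      using \<open>i \<in> I\<close> h by (auto simp: bij_betw_def)
    show ?thesis
      by (rule mono[OF that _ u[of y]]) (use y f'(4) in auto)
  qed
  moreover have "u \<le> q"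
  proof -
    obtain y where "y < l" using ne by auto
    then show ?thesis using u[of y] f'(1)[of y] q0(1) by (meson lessThan_iff order_trans)
  qed
  ultimately show ?thesis by blast
qed

section \<open>Distributivity and absoluteness\<close>

text \<open>No new functions on sets smaller than \<kappa>: finding a value at one index is dense
  and persists, so distributivity finds all of them at once, and \<open>g\<close> lies in the ground
  model.\<close>

lemma Q_decide_values:
  fixes q :: "'k::wellorder Q"
  assumes "inaccessible (UNIV :: 'k set)" "I \<prec> (UNIV :: 'k set)"
    and reg: "\<And>i y. regular_sentence (\<phi> i y)"
    and dense: "\<And>i r. i \<in> I \<Longrightarrow> r \<le> q \<Longrightarrow> \<exists>y. \<exists>s\<le>r. \<phi> i y s"
  obtains r g where "r \<le> q" "\<And>i. i \<in> I \<Longrightarrow> \<phi> i (g i) r"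
proof -
  have "\<exists>r\<le>q. \<forall>i\<in>I. \<exists>y. \<phi> i y r"
  proof (rule Q_distributive[OF assms(1,2)])
    show "\<exists>s\<le>r. \<exists>y. \<phi> i y s" if "i \<in> I" "r \<le> q" for i r
      using dense[OF that] by blast
    show "\<exists>y. \<phi> i y s" if "\<exists>y. \<phi> i y r" "s \<le> r" for i r s
      using that regular_mono[OF reg] by blast
  qed
  then show thesis
    using that by metis
qed

text \<open>The version for partial functions: every condition either has an extension fixing a
  value at \<open>i\<close> or itself excludes all values, and both alternatives persist.\<close>

lemma Q_decide_partial_values:
  fixes q :: "'k::wellorder Q"
  assumes "inaccessible (UNIV :: 'k set)" "I \<prec> (UNIV :: 'k set)"
    and mono: "\<And>i y r s. \<phi> i y r \<Longrightarrow> s \<le> r \<Longrightarrow> \<phi> i y s"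
  obtains r g where "r \<le> q" "\<And>i y s. i \<in> I \<Longrightarrow> s \<le> r \<Longrightarrow> \<phi> i y s \<Longrightarrow> \<phi> i (g i) r"
proof -
  have "\<exists>r\<le>q. \<forall>i\<in>I. (\<exists>y. \<phi> i y r) \<or> (\<forall>y. \<forall>s\<le>r. \<not> \<phi> i y s)"
  proof (rule Q_distributive[OF assms(1,2)])
    show "\<exists>s\<le>r. (\<exists>y. \<phi> i y s) \<or> (\<forall>y. \<forall>t\<le>s. \<not> \<phi> i y t)" for i r
      by blast
    show "(\<exists>y. \<phi> i y s) \<or> (\<forall>y. \<forall>t\<le>s. \<not> \<phi> i y t)"
      if "(\<exists>y. \<phi> i y r) \<or> (\<forall>y. \<forall>t\<le>r. \<not> \<phi> i y t)" "s \<le> r" for i r s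
      using that(1)
    proof
      assume "\<exists>y. \<phi> i y r"
      then show ?thesis
        using mono \<open>s \<le> r\<close> by blast
    next
      assume "\<forall>y. \<forall>t\<le>r. \<not> \<phi> i y t"
      then show ?thesis
        using order_trans[OF _ \<open>s \<le> r\<close>] by blast
    qed
  qed
  then obtain r where r: "r \<le> q" "\<forall>i\<in>I. (\<exists>y. \<phi> i y r) \<or> (\<forall>y. \<forall>s\<le>r. \<not> \<phi> i y s)"
    by blast
  show thesis
  proof (rule that[OF r(1)])
    show "\<phi> i (SOME y. \<phi> i y r) r" if "i \<in> I" "s \<le> r" "\<phi> i y s" for i y s
    proof -
      have "\<exists>y. \<phi> i y r"
        using r(2) that by blast
      then show ?thesis
        by (rule someI_ex)
    qed
  qed
qed

lemma evaluates_restrictI: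
  assumes "\<And>x. x \<in> A \<Longrightarrow> (x \<^bold>\<in> \<tau>) r \<or> (\<^bold>\<not> x \<^bold>\<in> \<tau>) r"
  shows "evaluates r (\<tau> \<restriction> A) {x \<in> A. (x \<^bold>\<in> \<tau>) r}"
  unfolding evaluates_def fmem_restrict
  using assms by (auto simp: fnot_iff intro: fmem_mono)

lemma Q_decide_set:
  fixes q :: "'k::wellorder Q" and \<tau> :: "('k Q, 'a) name"
  assumes "inaccessible (UNIV :: 'k set)" "A \<prec> (UNIV :: 'k set)"
  obtains r where "r \<le> q" "\<forall>x\<in>A. (x \<^bold>\<in> \<tau>) r \<or> (\<^bold>\<not> x \<^bold>\<in> \<tau>) r"
proof -
  \<comment> \<open>With values in \<open>unit\<close>, the only information at \<open>x\<close> is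
    whether membership can be forced.\<close>
  obtain r and g :: "'a \<Rightarrow> unit"
    where r: "r \<le> q" "\<And>x y s. x \<in> A \<Longrightarrow> s \<le> r \<Longrightarrow> (x \<^bold>\<in> \<tau>) s \<Longrightarrow> (x \<^bold>\<in> \<tau>) r"
    by (rule Q_decide_partial_values[OF assms, of "\<lambda>x _. x \<^bold>\<in> \<tau>" q]) (auto intro: fmem_mono)
  show thesis
    by (rule that[OF r(1)]) (use r(2) in \<open>auto simp: fnot_iff\<close>)
qed

text \<open>No new subsets of sets smaller than \<kappa>; the form of distributivity behind the
  absoluteness results.\<close>

lemma Q_evaluate_restrict:
  fixes q :: "'k::wellorder Q"
  assumes "inaccessible (UNIV :: 'k set)" "A \<prec> (UNIV :: 'k set)"
  obtains r X where "r \<le> q" "X \<subseteq> A" "evaluates r (\<tau> \<restriction> A) X"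
proof -
  obtain r where r: "r \<le> q" "\<forall>x\<in>A. (x \<^bold>\<in> \<tau>) r \<or> (\<^bold>\<not> x \<^bold>\<in> \<tau>) r"
    using Q_decide_set[OF assms] .
  show thesis
    by (rule that[OF r(1) _ evaluates_restrictI[OF r(2)[rule_format]]]) auto
qed

section \<open>Absoluteness of inaccessibility\<close>

lemma uncountable_G_if_inaccessible:
  fixes A :: "'k::wellorder set"
  assumes \<kappa>: "inaccessible (UNIV :: 'k set)" and A: "inaccessible A"
  shows "uncountable_G A (p :: 'k Q)"
  unfolding uncountable_G_iff
proof (intro allI impI notI)
  fix F :: "('k Q, 'k \<times> nat) name" and q
  assume F: "function_G A UNIV F q"
    and inj: "\<forall>x y n r. r \<le> q \<longrightarrow> ((x, n) \<^bold>\<in> F) r \<and> ((y, n) \<^bold>\<in> F) r \<longrightarrow> x = y"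
  \<comment> \<open>Indexing by the natural numbers, and not by \<open>A\<close>, keeps the index
    set below \<kappa> even when \<open>A\<close> is \<kappa>. Thus \<open>r\<close> decides the
    partial inverse of \<open>F\<close>, whose range is countable.\<close>
  obtain r g where r: "r \<le> q"
    and g: "\<And>n x s. n \<in> UNIV \<Longrightarrow> s \<le> r \<Longrightarrow> ((x, n) \<^bold>\<in> F) s \<Longrightarrow> ((g n, n) \<^bold>\<in> F) r"
    by (rule Q_decide_partial_values[OF \<kappa> inaccessible_nat_lesspoll[OF \<kappa>],
          of "\<lambda>n x. (x, n) \<^bold>\<in> F" q]) (auto intro: fmem_mono)
  have "\<not> A \<subseteq> range g"
    using A countable_subset[of A "range g"] by (auto simp: inaccessible_def)
  then obtain x where x: "x \<in> A" "x \<notin> range g"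
    by blast
  obtain n s where s: "s \<le> r" "((x, n) \<^bold>\<in> F) s"
    using F r x(1) unfolding function_G_iff by blast
  have "((g n, n) \<^bold>\<in> F) s"
    using g[OF UNIV_I s] s(1) by (rule fmem_mono)
  then have "x = g n"
    using inj s order_trans[OF s(1) r] by blast
  with x(2) show False
    by blast
qed

lemma inaccessible_G_if_inaccessible:
  fixes A :: "'k::wellorder set"
  assumes \<kappa>: "inaccessible (UNIV :: 'k set)" and A: "inaccessible A"
  shows "inaccessible_G A (p :: 'k Q)"
  unfolding inaccessible_G_iff
proof (intro conjI ballI allI impI notI)
  show "uncountable_G A p"
    using assms by (rule uncountable_G_if_inaccessible)
next
  fix \<beta> and F :: "('k Q, 'k \<times> 'k) name" and q r
  assume \<beta>: "\<beta> \<in> A" and F: "function_G {..<\<beta>} A F q" and rq: "r \<le> q"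
    and cof: "\<forall>x\<in>A. \<forall>s\<le>r. \<exists>\<xi> y t. t \<le> s \<and> ((\<xi>, y) \<^bold>\<in> F) t \<and> x \<le> y"
  have F: "((\<xi>, y) \<^bold>\<in> F) s \<Longrightarrow> \<xi> < \<beta> \<and> y \<in> A"
    "\<xi> < \<beta> \<Longrightarrow> \<exists>y. \<exists>t\<le>s. ((\<xi>, y) \<^bold>\<in> F) t"
    "((\<xi>, y) \<^bold>\<in> F) s \<Longrightarrow> ((\<xi>, z) \<^bold>\<in> F) s \<Longrightarrow> y = z" if "s \<le> q" for \<xi> y z s
    using F that unfolding function_G_iff by blast+
  \<comment> \<open>The domain \<beta> is small, so \<open>F\<close> becomes a ground model
    function, which regularity of \<open>A\<close> bounds.\<close>
  obtain s g where s: "s \<le> r" and g: "\<And>\<xi>. \<xi> \<in> {..<\<beta>} \<Longrightarrow> ((\<xi>, g \<xi>) \<^bold>\<in> F) s"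
  proof (rule Q_decide_values[OF \<kappa> lesspoll_UNIV[OF inaccessible_lesspoll[OF A \<beta>]],
          of "\<lambda>\<xi> y. (\<xi>, y) \<^bold>\<in> F" r])
    show "\<exists>y. \<exists>t\<le>s. ((\<xi>, y) \<^bold>\<in> F) t" if "\<xi> \<in> {..<\<beta>}" "s \<le> r" for \<xi> s
      using F(2)[of s \<xi>] that rq by auto
  qed auto
  have sq: "s \<le> q"
    using s rq by (rule order_trans)
  have "g ` {..<\<beta>} \<subseteq> A"
    using F(1)[OF sq g] by blast
  then obtain x where x: "x \<in> A" "\<forall>\<xi><\<beta>. g \<xi> < x"
    using inaccessible_regular[OF A \<beta>] by blast
  then obtain \<xi> y t where t: "t \<le> s" "((\<xi>, y) \<^bold>\<in> F) t" "x \<le> y"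
    using cof s by blast
  have tq: "t \<le> q"
    using t(1) sq by (rule order_trans)
  have "\<xi> < \<beta>"
    using F(1)[OF tq t(2)] by blast
  moreover from this have "g \<xi> = y"
    using F(3)[OF tq _ t(2)] fmem_mono[OF g t(1)] by simp
  ultimately show False
    using x t(3) by auto
next
  fix \<beta> and R :: "('k Q, 'k \<times> 'k) name" and q
  assume \<beta>: "\<beta> \<in> A" and R: "(R \<^bold>\<subseteq> A \<times> {..<\<beta>}) q"
    and inj: "\<forall>\<xi> \<eta>. \<xi> \<in> A \<and> \<eta> \<in> A \<longrightarrow> (\<forall>r\<le>q. (R \<^bold>! \<xi> \<^bold>= R \<^bold>! \<eta>) r \<longrightarrow> \<xi> = \<eta>)"
  have Pow: "Pow {..<\<beta>} \<prec> A"
    using inaccessible_Pow_lesspoll[OF A \<beta>] .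
  \<comment> \<open>Again the inverse is decided: \<open>g X\<close> is the index at which
    \<open>R\<close> takes the value \<open>X\<close>, if some extension makes it a value. The
    strong limit property makes this index set small.\<close>
  obtain r g where r: "r \<le> q"
    and g: "\<And>X \<xi> s. X \<in> Pow {..<\<beta>} \<Longrightarrow> s \<le> r \<Longrightarrow> \<xi> \<in> A \<and> evaluates s (R \<^bold>! \<xi>) X \<Longrightarrow>
        g X \<in> A \<and> evaluates r (R \<^bold>! (g X)) X"
    by (rule Q_decide_partial_values[OF \<kappa> lesspoll_UNIV[OF Pow],
          of "\<lambda>X \<xi> s. \<xi> \<in> A \<and> evaluates s (R \<^bold>! \<xi>) X" q]) (auto intro: evaluates_mono)
  have "\<not> A \<subseteq> g ` Pow {..<\<beta>}"
    using Pow subset_image_lepoll lepoll_antisym unfolding lesspoll_def by blast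
  then obtain \<xi> where \<xi>: "\<xi> \<in> A" "\<xi> \<notin> g ` Pow {..<\<beta>}"
    by blast
  \<comment> \<open>The entry at \<xi> is a ground model set too, as \<beta> gains no new subsets;
    injectivity then puts \<xi> into the range of \<open>g\<close>.\<close>
  obtain s X where s: "s \<le> r" "X \<subseteq> {..<\<beta>}" "evaluates s (R \<^bold>! \<xi> \<restriction> {..<\<beta>}) X"
    using Q_evaluate_restrict[OF \<kappa> lesspoll_UNIV[OF inaccessible_lesspoll[OF A \<beta>]]] .
  have sq: "s \<le> q"
    using s(1) r by (rule order_trans)
  have "(R \<^bold>! \<xi> \<^bold>\<subseteq> {..<\<beta>}) s"
    using regular_mono[OF regular_fsubset R sq] unfolding fsubset_iff fmem_at by blast
  with s have ev: "evaluates s (R \<^bold>! \<xi>) X"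
    by (blast intro: evaluates_unrestrict)
  with g[of X s \<xi>] s \<xi>(1) have gX: "g X \<in> A" "evaluates r (R \<^bold>! (g X)) X"
    by auto
  from evaluates_mono[OF this(2) s(1)] ev have "(R \<^bold>! \<xi> \<^bold>= R \<^bold>! (g X)) s"
    by (simp add: evaluates_feq)
  then have "\<xi> = g X"
    using inj \<xi>(1) gX(1) sq by blast
  with \<xi>(2) s(2) show False
    by blast
qed

lemma not_lepoll_imp_lesspoll: "\<not> A \<lesssim> B \<Longrightarrow> B \<prec> A"
  using card_of_ordLess[of A B] card_of_ordLeq[of B A] eqpoll_imp_lepoll[of A B] eqpoll_sym[of B A]
  by (auto simp: lesspoll_def lepoll_def dest: ordLess_imp_ordLeq)

text \<open>Downward absoluteness holds for every forcing order: a ground model counterexample has a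
  check name.\<close>

lemma inaccessible_if_inaccessible_G:
  fixes A :: "'k::wellorder set" and p :: "'p::order"
  assumes "inaccessible_G A p"
  shows "inaccessible A"
  unfolding inaccessible_def
proof (intro conjI ballI allI impI notI)
  assume "countable A"
  then obtain f :: "'k \<Rightarrow> nat" where f: "inj_on f A"
    by (auto simp: countable_def)
  let ?F = "check {(x, f x) | x. x \<in> A} :: ('p, 'k \<times> nat) name"
  have "function_G A UNIV ?F p"
    by (auto simp: function_G_iff)
  then have "\<not> (\<forall>x y. \<forall>n::nat. \<forall>r\<le>p. ((x, n) \<^bold>\<in> ?F) r \<and> ((y, n) \<^bold>\<in> ?F) r \<longrightarrow> x = y)"
    using assms unfolding inaccessible_G_iff uncountable_G_iff by blast
  with f show False
    by (auto simp: inj_on_def)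
next
  fix \<beta> f assume \<beta>: "\<beta> \<in> A" and f: "f ` {..<\<beta>} \<subseteq> A" "\<forall>x\<in>A. \<exists>\<xi><\<beta>. x \<le> f \<xi>"
  let ?F = "check {(\<xi>, f \<xi>) | \<xi>. \<xi> < \<beta>} :: ('p, 'k \<times> 'k) name"
  have "function_G {..<\<beta>} A ?F p"
    using f(1) by (auto simp: function_G_iff)
  then have "\<not> (\<forall>x\<in>A. \<forall>s\<le>p. \<exists>\<xi> y. \<exists>t\<le>s. ((\<xi>, y) \<^bold>\<in> ?F) t \<and> x \<le> y)"
    using assms \<beta> unfolding inaccessible_G_iff by blast
  with f(2) show False
    by auto
next
  fix \<beta> assume \<beta>: "\<beta> \<in> A"
  show "Pow {..<\<beta>} \<prec> A"
  proof (rule not_lepoll_imp_lesspoll, rule notI)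
    assume "A \<lesssim> Pow {..<\<beta>}"
    then obtain h where h: "inj_on h A" "h ` A \<subseteq> Pow {..<\<beta>}"
      by (auto simp: lepoll_def)
    let ?R = "check {(\<xi>, y). \<xi> \<in> A \<and> y \<in> h \<xi>} :: ('p, 'k \<times> 'k) name"
    have "(?R \<^bold>\<subseteq> A \<times> {..<\<beta>}) p"
      using h(2) by (auto simp: fsubset_iff)
    then obtain \<xi> \<eta> r where "\<xi> \<in> A" "\<eta> \<in> A" "(?R \<^bold>! \<xi> \<^bold>= ?R \<^bold>! \<eta>) r" "\<xi> \<noteq> \<eta>"
      using assms \<beta> unfolding inaccessible_G_iff by blast
    then have "h \<xi> = h \<eta>" "\<xi> \<noteq> \<eta>"
      by (auto simp: feq_iff fmem_at)
    with h(1) \<open>\<xi> \<in> A\<close> \<open>\<eta> \<in> A\<close> show False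
      by (auto simp: inj_on_def)
  qed
qed

section \<open>Absoluteness of clubs, stationary sets and 1-clubs\<close>

lemma club_G_absolute:
  assumes ev: "evaluates p C X"
  shows "club_G A C p \<longleftrightarrow> club A X"
proof
  assume L: "club_G A C p"
  show "club A X"
    unfolding club_def
  proof (intro conjI ballI impI)
    show "X \<subseteq> A"
      using L evaluatesD[OF ev order_refl] unfolding club_G_iff by blast
    show "\<exists>y\<in>X. x \<le> y" if "x \<in> A" for x
    proof -
      obtain y r where "r \<le> p" "(y \<^bold>\<in> C) r" "x \<le> y"
        using L \<open>x \<in> A\<close> unfolding club_G_iff by blast
      then show ?thesis
        using evaluatesD[OF ev] by blast
    qed
  next
    fix \<delta> assume \<delta>: "\<delta> \<in> A" and *: "(\<exists>x. x < \<delta>) \<and> (\<forall>x<\<delta>. \<exists>y\<in>X. x < y \<and> y < \<delta>)"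
    have "\<forall>x<\<delta>. \<forall>r\<le>p. \<exists>y. \<exists>s\<le>r. (y \<^bold>\<in> C) s \<and> x < y \<and> y < \<delta>"
      using * evaluatesD[OF ev] by blast
    then have "(\<delta> \<^bold>\<in> C) p"
      using L \<delta> * unfolding club_G_iff by blast
    then show "\<delta> \<in> X"
      using evaluatesD[OF ev order_refl] by blast
  qed
next
  assume R: "club A X"
  show "club_G A C p"
    unfolding club_G_iff
  proof (intro conjI ballI allI impI)
    show "x \<in> A" if "q \<le> p" "(x \<^bold>\<in> C) q" for x q
      using R evaluatesD[OF ev that(1)] that(2) unfolding club_def by blast
    show "\<exists>y. \<exists>r\<le>q. (y \<^bold>\<in> C) r \<and> x \<le> y" if "x \<in> A" "q \<le> p" for x q
      using R evaluatesD[OF ev that(2)] that(1) unfolding club_def by blast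
  next
    fix \<delta> q assume \<delta>: "\<delta> \<in> A" "\<exists>x. x < \<delta>" "q \<le> p"
      and *: "\<forall>x<\<delta>. \<forall>r\<le>q. \<exists>y. \<exists>s\<le>r. (y \<^bold>\<in> C) s \<and> x < y \<and> y < \<delta>"
    have "\<exists>y\<in>X. x < y \<and> y < \<delta>" if "x < \<delta>" for x
    proof -
      obtain y s where "s \<le> q" "(y \<^bold>\<in> C) s" "x < y" "y < \<delta>"
        using * \<open>x < \<delta>\<close> by blast
      then show ?thesis
        using evaluatesD[OF ev order_trans[OF _ \<delta>(3)]] by blast
    qed
    then have "\<delta> \<in> X"
      using R \<delta>(1,2) unfolding club_def by blast
    then show "(\<delta> \<^bold>\<in> C) q"
      using evaluatesD[OF ev \<delta>(3)] by blast
  qed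
qed

text \<open>Ground model clubs remain clubs, so a set stationary in the extension meets each of
  them.\<close>

lemma stationary_if_stationary_G:
  assumes ev: "evaluates p S X" and st: "stationary_G A S p"
  shows "stationary A X"
  unfolding stationary_def
proof (intro conjI allI impI)
  show "X \<subseteq> A"
    using st evaluatesD[OF ev order_refl] unfolding stationary_G_iff by blast
  fix C assume "club A C"
  then have "club_G A (check C) p"
    using club_G_absolute[OF evaluates_check] by blast
  then obtain x r where "r \<le> p" "(x \<^bold>\<in> check C) r" "(x \<^bold>\<in> S) r"
    using st unfolding stationary_G_iff by blast
  then show "\<exists>x. x \<in> C \<and> x \<in> X"
    using evaluatesD[OF ev] by auto
qed

text \<open>For the converse, a club of the extension in a small \<open>A\<close> is evaluated by
  some extension and is therefore a ground model club.\<close>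

lemma stationary_G_absolute:
  fixes p :: "'k::wellorder Q"
  assumes \<kappa>: "inaccessible (UNIV :: 'k set)" and A: "A \<prec> (UNIV :: 'k set)"
    and ev: "evaluates p S X"
  shows "stationary_G A S p \<longleftrightarrow> stationary A X"
proof
  assume R: "stationary A X"
  show "stationary_G A S p"
    unfolding stationary_G_iff
  proof (intro conjI allI impI)
    show "x \<in> A" if "q \<le> p" "(x \<^bold>\<in> S) q" for x q
      using R evaluatesD[OF ev that(1)] that(2) unfolding stationary_def by blast
  next
    fix C q r assume qr: "q \<le> p" "r \<le> q" and C: "club_G A C q"
    obtain s Z where s: "s \<le> r" and "evaluates s (C \<restriction> A) Z"
      using Q_evaluate_restrict[OF \<kappa> A] .
    have sq: "s \<le> q"
      using s qr(2) by (rule order_trans)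
    have Cs: "club_G A C s"
      using C sq by (rule regular_mono[OF regular_club_G])
    then have "(C \<^bold>\<subseteq> A) s"
      unfolding club_G_iff fsubset_iff by blast
    with \<open>evaluates s (C \<restriction> A) Z\<close> have Z: "evaluates s C Z"
      by (rule evaluates_unrestrict)
    with Cs have "club A Z"
      by (simp add: club_G_absolute)
    with R obtain x where "x \<in> Z" "x \<in> X"
      unfolding stationary_def by blast
    then have "(x \<^bold>\<in> C) s" "(x \<^bold>\<in> S) s"
      using evaluatesD[OF Z order_refl] evaluatesD[OF ev order_trans[OF sq qr(1)]] by auto
    with s show "\<exists>x. \<exists>s\<le>r. (x \<^bold>\<in> C) s \<and> (x \<^bold>\<in> S) s"
      by blast
  qed
qed (rule stationary_if_stationary_G[OF ev])

text \<open>Every closure requirement that arises in the extension is already one in the ground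
  model, by downward absoluteness.\<close>

lemma one_club_G_if_one_club:
  fixes p :: "'k::wellorder Q"
  assumes \<kappa>: "inaccessible (UNIV :: 'k set)" and A: "A \<prec> (UNIV :: 'k set)"
    and ev: "evaluates p C X" and X: "one_club A X"
  shows "one_club_G A C p"
  unfolding one_club_G_iff
proof (intro conjI ballI allI impI)
  show "stationary_G A C p"
    using X stationary_G_absolute[OF \<kappa> A ev] by (simp add: one_club_def)
next
  fix \<beta> q assume \<beta>: "\<beta> \<in> A" and q: "q \<le> p"
    and *: "inaccessible_G {..<\<beta>} q \<and> stationary_G {..<\<beta>} (C \<restriction> {..<\<beta>}) q"
  have evq: "evaluates q C X"
    using ev q by (rule evaluates_mono)
  have "inaccessible {..<\<beta>}" "stationary {..<\<beta>} (X \<inter> {..<\<beta>})"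
    using * inaccessible_if_inaccessible_G stationary_if_stationary_G[OF evaluates_restrict[OF evq]]
    by blast+
  with X \<beta> have "\<beta> \<in> X"
    by (simp add: one_club_def)
  then show "(\<beta> \<^bold>\<in> C) q"
    using evaluatesD[OF ev q] by blast
qed

section \<open>Reflection from the square sequence\<close>

lemma Refl0_G_iff:
  "Refl0_G A p \<longleftrightarrow> inaccessible_G A p \<and>
     (\<forall>S. \<forall>q\<le>p. stationary_G A S q \<longrightarrow> (\<forall>r\<le>q. \<exists>\<alpha>. \<exists>s\<le>r. \<alpha> \<in> A \<and>
        inaccessible_G {..<\<alpha>} s \<and> stationary_G {..<\<alpha>} (S \<restriction> {..<\<alpha>}) s))"
  unfolding Refl0_G_def
  by (simp add: fsimps,
      simp only: fimp_iff regular_simps regular_stationary_G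
      regular_inaccessible_G, simp add: fsimps)

text \<open>What \<open>square1_G\<close> demands of a single sequence \<open>C\<close>, with the
  connectives unfolded.\<close>

definition square_seq_G :: "'k::wellorder set \<Rightarrow> ('p::order, 'k \<times> 'k) name \<Rightarrow> 'p sentence" where
  "square_seq_G A C p \<longleftrightarrow>
     (\<forall>\<alpha>\<in>A. \<forall>q\<le>p. inaccessible_G {..<\<alpha>} q \<longrightarrow> one_club_G {..<\<alpha>} (C \<^bold>! \<alpha>) q) \<and>
     (\<forall>\<alpha> \<beta>. \<alpha> \<in> A \<and> \<beta> \<in> A \<and> \<alpha> < \<beta> \<longrightarrow> (\<forall>q\<le>p. inaccessible_G {..<\<alpha>} q \<and>
        inaccessible_G {..<\<beta>} q \<and> stationary_G {..<\<alpha>} (C \<^bold>! \<beta> \<restriction> {..<\<alpha>}) q \<longrightarrow>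
        (C \<^bold>! \<alpha> \<^bold>= C \<^bold>! \<beta> \<restriction> {..<\<alpha>}) q)) \<and>
     (\<forall>D. \<forall>q\<le>p. \<not> (one_club_G A D q \<and> (\<forall>\<alpha>\<in>A. \<forall>r\<le>q. inaccessible_G {..<\<alpha>} r \<and>
        stationary_G {..<\<alpha>} (D \<restriction> {..<\<alpha>}) r \<longrightarrow> (C \<^bold>! \<alpha> \<^bold>= D \<restriction> {..<\<alpha>}) r)))"

lemma square1_G_iff: "square1_G A p \<longleftrightarrow> (\<forall>q\<le>p. \<exists>C. \<exists>r\<le>q. square_seq_G A C r)"
  unfolding square1_G_def square_seq_G_def
  by (simp add: fsimps,
      simp only: fimp_iff regular_simps regular_stationary_G
      regular_inaccessible_G regular_one_club_G, simp add: fsimps Ball_def Bex_def)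

text \<open>A stationary set that does not reflect is vacuously a thread through every sequence.\<close>

lemma Refl0_G_if_square1_G:
  fixes p :: "'p::order" and A :: "'k::wellorder set"
  assumes inac: "inaccessible_G A p" and sq: "square1_G A p"
  shows "Refl0_G A p"
  unfolding Refl0_G_iff
proof (intro conjI allI impI inac)
  fix S :: "('p, 'k) name" and q r
  assume q: "q \<le> p" "r \<le> q" and S: "stationary_G A S q"
  show "\<exists>\<alpha>. \<exists>s\<le>r. \<alpha> \<in> A \<and> inaccessible_G {..<\<alpha>} s \<and> stationary_G {..<\<alpha>} (S \<restriction> {..<\<alpha>}) s"
  proof (rule ccontr)
    assume neg: "\<not> ?thesis"
    have "r \<le> p"
      using q(2,1) by (rule order_trans)
    with sq obtain C s where s: "s \<le> r" "square_seq_G A C s"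
      unfolding square1_G_iff by blast
    have neg: "\<not> (inaccessible_G {..<\<alpha>} t \<and> stationary_G {..<\<alpha>} (S \<restriction> {..<\<alpha>}) t)"
      if "\<alpha> \<in> A" "t \<le> s" for \<alpha> t
      using neg \<open>\<alpha> \<in> A\<close> order_trans[OF \<open>t \<le> s\<close> s(1)] by blast
    have "stationary_G A S s"
      using S order_trans[OF s(1) q(2)] by (rule regular_mono[OF regular_stationary_G])
    with neg have "one_club_G A S s"
      unfolding one_club_G_iff by blast
    with neg s(2) show False
      unfolding square_seq_G_def by blast
  qed
qed

section \<open>The generic sequence\<close>

text \<open>The union of the generic filter, coded as a subset of \<kappa> \<times>
  \<kappa>.\<close>

definition generic_seq :: "('k::wellorder Q, 'k \<times> 'k) name" where
  "generic_seq = name_of (\<lambda>(\<alpha>, x) s. \<alpha> \<in> dom (Rep_Q s) \<and> x \<in> the (Rep_Q s \<alpha>))"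

text \<open>Extensions never change an existing entry, so a condition with an entry at \<alpha>
  decides it completely.\<close>

lemma evaluates_generic_seq:
  assumes "\<alpha> \<in> dom (Rep_Q r)"
  shows "evaluates r (generic_seq \<^bold>! \<alpha>) (the (Rep_Q r \<alpha>))"
  unfolding evaluates_def
proof (intro allI impI)
  fix q x assume q: "q \<le> r"
  have Rep: "Rep_Q s \<alpha> = Rep_Q r \<alpha>" if "s \<le> r" for s
    using Rep_Q_le[OF that assms] .
  have *: "(x \<^bold>\<in> generic_seq \<^bold>! \<alpha>) q \<longleftrightarrow>
      (\<forall>s\<le>q. \<exists>t\<le>s. \<alpha> \<in> dom (Rep_Q t) \<and> x \<in> the (Rep_Q t \<alpha>))"
    unfolding fmem_at generic_seq_def
  proof (subst fmem_name_of_dense)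
    show "(case (\<alpha>, x) of (\<alpha>, x) \<Rightarrow> \<lambda>s. \<alpha> \<in> dom (Rep_Q s) \<and> x \<in> the (Rep_Q s \<alpha>)) t"
      if "(case (\<alpha>, x) of (\<alpha>, x) \<Rightarrow> \<lambda>s. \<alpha> \<in> dom (Rep_Q s) \<and> x \<in> the (Rep_Q s \<alpha>)) s" "t \<le> s" for s t
      using that Rep_Q_le[OF that(2), of \<alpha>] by (auto simp: domIff)
  qed simp
  have "\<alpha> \<in> dom (Rep_Q t) \<and> x \<in> the (Rep_Q t \<alpha>) \<longleftrightarrow> x \<in> the (Rep_Q r \<alpha>)" if "t \<le> q" for t
    using Rep[OF order_trans[OF that q]] assms by (simp add: domIff)
  then show "(x \<^bold>\<in> generic_seq \<^bold>! \<alpha>) q \<longleftrightarrow> x \<in> the (Rep_Q r \<alpha>)"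
    unfolding * using order_trans by blast
qed

text \<open>Weaker than \<open>has_length\<close>, but inherited by stronger conditions and smaller
  ordinals.\<close>

definition reaches :: "'k::wellorder Q \<Rightarrow> 'k \<Rightarrow> bool" where
  "reaches r \<gamma> \<longleftrightarrow> inacc \<inter> {..\<gamma>} \<subseteq> dom (Rep_Q r)"

lemma reaches_extend: obtains r where "r \<le> q" "reaches r \<gamma>"
proof -
  obtain r \<delta> where "r \<le> q" "\<gamma> \<le> \<delta>" "has_length r \<delta>"
    using extend_length by blast
  then show thesis
    by (intro that[of r]) (auto simp: reaches_def has_length_def)
qed

lemma reaches_mono: "reaches r \<gamma> \<Longrightarrow> s \<le> r \<Longrightarrow> reaches s \<gamma>"
  using map_le_implies_dom_le unfolding reaches_def le_Q_iff by blast

lemma reaches_down: "reaches r \<gamma> \<Longrightarrow> \<beta> \<le> \<gamma> \<Longrightarrow> reaches r \<beta>"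
  unfolding reaches_def by auto

lemma reaches_dom: "reaches r \<gamma> \<Longrightarrow> inaccessible {..<\<alpha>} \<Longrightarrow> \<alpha> \<le> \<gamma> \<Longrightarrow> \<alpha> \<in> dom (Rep_Q r)"
  by (auto simp: reaches_def inacc_iff)

lemma has_length_reaches: "has_length r \<gamma> \<Longrightarrow> reaches r \<gamma>"
  by (simp add: reaches_def has_length_def)

section \<open>The generic sequence consists of coherent 1-clubs\<close>

lemma generic_seq_one_club:
  fixes q :: "'k::wellorder Q"
  assumes \<kappa>: "inaccessible (UNIV :: 'k set)" and "inaccessible_G {..<\<alpha>} q"
  shows "one_club_G {..<\<alpha>} (generic_seq \<^bold>! \<alpha>) q"
proof (rule regular_dense[OF regular_one_club_G])
  fix q' assume "q' \<le> q"
  have i: "inaccessible {..<\<alpha>}"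
    using assms(2) by (rule inaccessible_if_inaccessible_G)
  \<comment> \<open>By regularity it suffices to treat a dense set of conditions, here those with an
    entry at \<alpha>.\<close>
  obtain r where r: "r \<le> q'" "reaches r \<alpha>"
    using reaches_extend .
  have \<alpha>: "\<alpha> \<in> dom (Rep_Q r)"
    using reaches_dom[OF r(2) i] by simp
  have "one_club_G {..<\<alpha>} (generic_seq \<^bold>! \<alpha>) r"
    using \<kappa> inaccessible_lesspoll[OF \<kappa> UNIV_I] evaluates_generic_seq[OF \<alpha>] one_club_Rep[OF \<alpha>]
    by (rule one_club_G_if_one_club)
  with r(1) show "\<exists>r\<le>q'. one_club_G {..<\<alpha>} (generic_seq \<^bold>! \<alpha>) r"
    by blast
qed

lemma generic_seq_coherent:
  fixes q :: "'k::wellorder Q"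
  assumes "\<alpha> < \<beta>" "inaccessible_G {..<\<alpha>} q" "inaccessible_G {..<\<beta>} q"
    and st: "stationary_G {..<\<alpha>} (generic_seq \<^bold>! \<beta> \<restriction> {..<\<alpha>}) q"
  shows "(generic_seq \<^bold>! \<alpha> \<^bold>= generic_seq \<^bold>! \<beta> \<restriction> {..<\<alpha>}) q"
proof (rule regular_dense[OF regular_feq])
  fix q' assume q': "q' \<le> q"
  obtain r where r: "r \<le> q'" "reaches r \<beta>"
    using reaches_extend .
  have d: "\<alpha> \<in> dom (Rep_Q r)" "\<beta> \<in> dom (Rep_Q r)"
    using reaches_dom[OF r(2)] assms(1) inaccessible_if_inaccessible_G[OF assms(2)]
      inaccessible_if_inaccessible_G[OF assms(3)] by auto
  note ev = evaluates_generic_seq[OF d(1)] evaluates_restrict[OF evaluates_generic_seq[OF d(2)]]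
  have "stationary_G {..<\<alpha>} (generic_seq \<^bold>! \<beta> \<restriction> {..<\<alpha>}) r"
    using st order_trans[OF r(1) q'] by (rule regular_mono[OF regular_stationary_G])
  then have "stationary {..<\<alpha>} (the (Rep_Q r \<beta>) \<inter> {..<\<alpha>})"
    by (rule stationary_if_stationary_G[OF ev(2)])
  then have "(generic_seq \<^bold>! \<alpha> \<^bold>= generic_seq \<^bold>! \<beta> \<restriction> {..<\<alpha>}) r"
    using evaluates_feq[OF ev] coherent_Rep[OF d] by blast
  with r(1) show "\<exists>r\<le>q'. (generic_seq \<^bold>! \<alpha> \<^bold>= generic_seq \<^bold>! \<beta> \<restriction> {..<\<alpha>}) r"
    by blast
qed

section \<open>Initial segments of conditions\<close>

definition cut_at :: "'k::wellorder Q \<Rightarrow> 'k \<Rightarrow> 'k Q" where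
  "cut_at r \<gamma> = Abs_Q (Rep_Q r |` {..\<gamma>})"

lemma Rep_cut_at: "Rep_Q (cut_at r \<gamma>) = Rep_Q r |` {..\<gamma>}"
  unfolding cut_at_def
proof (rule Rep_Q_Abs_Q)
  obtain \<delta> where "has_length r \<delta>"
    using has_length_exists by blast
  then have "dom (Rep_Q r |` {..\<gamma>}) = inacc \<inter> {..min \<gamma> \<delta>}"
    by (auto simp: has_length_def)
  then have "\<exists>\<gamma>'. dom (Rep_Q r |` {..\<gamma>}) = inacc \<inter> {..\<gamma>'}"
    by blast
  moreover have "\<alpha> \<in> dom (Rep_Q r)" "(Rep_Q r |` {..\<gamma>}) \<alpha> = Rep_Q r \<alpha>"
    if "\<alpha> \<in> dom (Rep_Q r |` {..\<gamma>})" for \<alpha>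
    using that by (auto simp: restrict_map_def split: if_splits)
  ultimately show "is_condition (Rep_Q r |` {..\<gamma>})"
    unfolding is_condition_def using one_club_Rep[of _ r] coherent_Rep[of _ r] by metis
qed

lemma le_cut_at: "r \<le> cut_at r \<gamma>"
  by (simp add: le_Q_iff Rep_cut_at map_le_def)

text \<open>A condition that reaches \<gamma> has fixed all entries up to \<gamma> for its
  extensions.\<close>

lemma cut_at_eq:
  assumes "s \<le> r" "reaches r \<gamma>"
  shows "cut_at s \<gamma> = cut_at r \<gamma>"
proof -
  have "Rep_Q s \<alpha> = Rep_Q r \<alpha>" if "\<alpha> \<le> \<gamma>" for \<alpha>
  proof (cases "\<alpha> \<in> inacc")
    case True
    with assms(2) that have "\<alpha> \<in> dom (Rep_Q r)"
      by (auto simp: reaches_def)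
    with assms(1) show ?thesis
      by (rule Rep_Q_le)
  next
    case False
    then have "\<alpha> \<notin> dom (Rep_Q s)" "\<alpha> \<notin> dom (Rep_Q r)"
      using dom_Rep_inacc by (auto simp: inacc_iff)
    then show ?thesis
      by (simp add: domIff)
  qed
  then show ?thesis
    unfolding cut_at_def by (intro arg_cong[where f = Abs_Q]) (auto simp: restrict_map_def)
qed

lemma cut_at_self: "has_length r \<gamma> \<Longrightarrow> cut_at r \<gamma> = r"
  unfolding Rep_Q_inject[symmetric] Rep_cut_at has_length_def
  by (rule ext) (auto simp: restrict_map_def domIff)

section \<open>Threads through the generic sequence\<close>

definition decides :: "('p::order, 'x) name \<Rightarrow> 'x \<Rightarrow> 'p \<Rightarrow> bool" where
  "decides D x r \<longleftrightarrow> (x \<^bold>\<in> D) r \<or> (\<^bold>\<not> x \<^bold>\<in> D) r"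

lemma decides_mono: "decides D x r \<Longrightarrow> s \<le> r \<Longrightarrow> decides D x s"
  unfolding decides_def
  by (erule disj_forward) (auto intro: fmem_mono regular_mono[OF regular_fnot[OF regular_fmem]])

text \<open>The strict bound \<open>\<gamma> < \<delta>\<close> leaves the entry at \<delta> free to
  be changed without affecting decisions below \<delta>. Staying above \<open>\<gamma>0\<close>
  protects a starting condition of that length from such a change.\<close>

definition decision_points :: "('k::wellorder Q, 'k) name \<Rightarrow> 'k \<Rightarrow> 'k Q \<Rightarrow> 'k set" where
  "decision_points D \<gamma>0 r = {\<delta>. \<gamma>0 < \<delta> \<and> (\<forall>\<beta><\<delta>. \<exists>\<gamma><\<delta>. decides D \<beta> (cut_at r \<gamma>))}"

text \<open>Only cuts below \<delta> enter the definition, and these are fixed once \<open>r\<close>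
  reaches \<delta>.\<close>

lemma decision_points_stable:
  assumes "s \<le> r" "reaches r \<delta>"
  shows "\<delta> \<in> decision_points D \<gamma>0 s \<longleftrightarrow> \<delta> \<in> decision_points D \<gamma>0 r"
proof -
  have "cut_at s \<gamma> = cut_at r \<gamma>" if "\<gamma> < \<delta>" for \<gamma>
    using cut_at_eq[OF assms(1) reaches_down[OF assms(2)]] that by simp
  then show ?thesis
    by (simp add: decision_points_def cong: conj_cong)
qed

text \<open>A name for the intersection of \<open>B\<close> with the club of decision points.\<close>

definition decided_part :: "('k::wellorder Q, 'k) name \<Rightarrow> 'k \<Rightarrow> ('k Q, 'k) name \<Rightarrow> ('k Q, 'k) name" where
  "decided_part D \<gamma>0 B =
     name_of (\<lambda>\<delta> s. reaches s \<delta> \<and> \<delta> \<in> decision_points D \<gamma>0 s \<and> (\<delta> \<^bold>\<in> B) s)"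

lemma fmem_decided_part_dense:
  "(\<delta> \<^bold>\<in> decided_part D \<gamma>0 B) r \<longleftrightarrow>
     (\<forall>q\<le>r. \<exists>s\<le>q. reaches s \<delta> \<and> \<delta> \<in> decision_points D \<gamma>0 s \<and> (\<delta> \<^bold>\<in> B) s)"
  unfolding decided_part_def
proof (rule fmem_name_of_dense, elim conjE, intro conjI)
  fix p q :: "'a Q"
  assume "reaches p \<delta>" "\<delta> \<in> decision_points D \<gamma>0 p" "(\<delta> \<^bold>\<in> B) p" "q \<le> p"
  then show "reaches q \<delta>" "\<delta> \<in> decision_points D \<gamma>0 q" "(\<delta> \<^bold>\<in> B) q"
    by (simp_all add: reaches_mono[of p \<delta> q] decision_points_stable[of q p] fmem_mono[of \<delta> B p q])
qed

lemma fmem_decided_part: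
  assumes "reaches r \<delta>"
  shows "(\<delta> \<^bold>\<in> decided_part D \<gamma>0 B) r \<longleftrightarrow> \<delta> \<in> decision_points D \<gamma>0 r \<and> (\<delta> \<^bold>\<in> B) r"
proof
  assume L: "(\<delta> \<^bold>\<in> decided_part D \<gamma>0 B) r"
  then obtain s where "s \<le> r" "\<delta> \<in> decision_points D \<gamma>0 s"
    unfolding fmem_decided_part_dense by blast
  then have "\<delta> \<in> decision_points D \<gamma>0 r"
    using decision_points_stable[OF _ assms] by blast
  moreover have "(\<delta> \<^bold>\<in> B) r"
    using L unfolding fmem_decided_part_dense by (intro regular_dense[OF regular_fmem]) blast
  ultimately show "\<delta> \<in> decision_points D \<gamma>0 r \<and> (\<delta> \<^bold>\<in> B) r"
    by blast
next
  assume "\<delta> \<in> decision_points D \<gamma>0 r \<and> (\<delta> \<^bold>\<in> B) r"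
  then show "(\<delta> \<^bold>\<in> decided_part D \<gamma>0 B) r"
    unfolding fmem_decided_part_dense
    using reaches_mono[OF assms] decision_points_stable[OF _ assms] fmem_mono[of \<delta> B r] by blast
qed

text \<open>Build a descending \<omega>-sequence in which each step decides \<open>D\<close> below
  the previous length and forces a point of \<open>B\<close> between consecutive lengths. The
  supremum of the lengths is a limit of \<open>B\<close>, and the members, as proper initial
  segments of the union, decide \<open>D\<close> below it.\<close>

lemma decided_part_unbounded:
  fixes q :: "'k::wellorder Q"
  assumes \<kappa>: "inaccessible (UNIV :: 'k set)" and B: "club_G UNIV B q"
  shows "\<exists>y. \<exists>r\<le>q. (y \<^bold>\<in> decided_part D \<gamma>0 B) r \<and> x \<le> y"
proof -
  \<comment> \<open>Since \<open>chain_union\<close> asks for an index set enumerated by some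
    \<open>{..<l}\<close>, the natural numbers are presented this way.\<close>
  obtain l :: 'k and h :: "'k \<Rightarrow> nat" where h: "bij_betw h {..<l} UNIV"
    using bij_initial_segment[OF inaccessible_nat_lesspoll[OF \<kappa>]] .
  define T where "T n z \<longleftrightarrow> fst z \<le> q \<and> has_length (fst z) (snd z) \<and> (n = 0 \<longrightarrow> max x (max \<gamma>0 l) \<le> snd z)"
    for n :: nat and z :: "'k Q \<times> 'k"
  define N where "N z z' \<longleftrightarrow> fst z' \<le> fst z \<and> (\<forall>\<beta><snd z. decides D \<beta> (fst z')) \<and>
    (\<exists>y. snd z < y \<and> y < snd z' \<and> (y \<^bold>\<in> B) (fst z'))" for z z' :: "'k Q \<times> 'k"
  have "\<exists>f. \<forall>n. T n (f n) \<and> N (f n) (f (Suc n))"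
  proof (rule dependent_nat_choice)
    obtain r \<delta> where "r \<le> q" "max x (max \<gamma>0 l) \<le> \<delta>" "has_length r \<delta>"
      using extend_length by blast
    then have "T 0 (r, \<delta>)"
      by (simp add: T_def)
    then show "\<exists>z. T 0 z" ..
  next
    fix z n assume "T n z"
    obtain r d where z: "z = (r, d)"
      by (cases z)
    with \<open>T n z\<close> have r: "r \<le> q" "has_length r d"
      by (auto simp: T_def)
    obtain s where s: "s \<le> r" "\<forall>\<beta>\<in>{..<d}. (\<beta> \<^bold>\<in> D) s \<or> (\<^bold>\<not> \<beta> \<^bold>\<in> D) s"
      using Q_decide_set[OF \<kappa> inaccessible_lesspoll[OF \<kappa> UNIV_I]] .
    \<comment> \<open>The auxiliary ordinals \<open>d1\<close> and \<open>d2\<close> make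
      \<open>y\<close> lie strictly between the old length and the new one.\<close>
    obtain d1 where d1: "d < d1"
      using inaccessible_limit[OF \<kappa>, of d] by blast
    obtain y t where t: "t \<le> s" "(y \<^bold>\<in> B) t" "d1 \<le> y"
      using B order_trans[OF s(1) r(1)] unfolding club_G_iff by blast
    obtain d2 where d2: "y < d2"
      using inaccessible_limit[OF \<kappa>, of y] by blast
    obtain t' d3 where t': "t' \<le> t" "d2 \<le> d3" "has_length t' d3"
      using extend_length by blast
    have ts: "t' \<le> s"
      using t'(1) t(1) by (rule order_trans)
    have "T (Suc n) (t', d3)"
      using t'(3) order_trans[OF order_trans[OF ts s(1)] r(1)] by (simp add: T_def)
    moreover have "N z (t', d3)"
      unfolding N_def z fst_conv snd_conv
    proof (intro conjI allI impI exI[of _ y])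
      show "t' \<le> r"
        using ts s(1) by (rule order_trans)
      show "decides D \<beta> t'" if "\<beta> < d" for \<beta>
        using that s(2) by (intro decides_mono[OF _ ts]) (simp add: decides_def)
    qed (use d1 t(3) d2 t'(2) fmem_mono[OF t(2) t'(1)] in auto)
    ultimately show "\<exists>z'. T (Suc n) z' \<and> N z z'"
      by blast
  qed
  then obtain f where f: "\<And>n. T n (f n)" "\<And>n. N (f n) (f (Suc n))"
    by blast
  define r where "r n = fst (f n)" for n
  define d where "d n = snd (f n)" for n
  have r: "r n \<le> q" "has_length (r n) (d n)" "r (Suc n) \<le> r n" for n
    using f(1)[of n] f(2)[of n] by (auto simp: T_def N_def r_def d_def)
  have dec: "decides D \<beta> (r (Suc n))" if "\<beta> < d n" for \<beta> n
    using f(2)[of n] that by (auto simp: N_def r_def d_def)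
  have y: "\<exists>y. d n < y \<and> y < d (Suc n) \<and> (y \<^bold>\<in> B) (r (Suc n))" for n
    using f(2)[of n] by (auto simp: N_def r_def d_def)
  have d_Suc: "d n < d (Suc n)" for n
    using y[of n] by auto
  have d0: "x \<le> d 0" "\<gamma>0 \<le> d 0" "l \<le> d 0"
    using f(1)[of 0] by (auto simp: T_def d_def)
  have d_mono: "d 0 \<le> d n" for n
    using lift_Suc_mono_le[of d 0 n] d_Suc by (simp add: less_imp_le)
  have r_anti: "r m \<le> r n" if "n \<le> m" for n m
    using lift_Suc_antimono_le[of r, OF r(3) that] .
  obtain u \<delta> where u: "has_length u \<delta>" "\<And>n. n \<in> UNIV \<Longrightarrow> u \<le> r n" "\<And>n. n \<in> UNIV \<Longrightarrow> d n \<le> \<delta>"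
    and lub: "\<And>z. z < \<delta> \<Longrightarrow> \<exists>n\<in>UNIV. z < d n"
  proof (rule chain_union[OF \<kappa>, of UNIV h l r d])
    show "UNIV = h ` {..<l}"
      using h by (simp add: bij_betw_def)
    show "l \<le> d n" for n
      using d0(3) d_mono by (rule order_trans)
    show "r i \<le> r j \<or> r j \<le> r i" for i j
      using r_anti[of i j] r_anti[of j i] by (cases "i \<le> j") auto
  qed (use r in auto)
  have d_less: "d n < \<delta>" for n
    using d_Suc[of n] u(3)[of "Suc n"] by simp
  have u_r: "u \<le> r n" for n
    using u(2) by simp
  have uq: "u \<le> q"
    using u_r[of 0] r(1)[of 0] by (rule order_trans)
  have "\<delta> \<in> decision_points D \<gamma>0 u"
    unfolding decision_points_def
  proof (intro CollectI conjI allI impI)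
    show "\<gamma>0 < \<delta>"
      using d0(2) d_less[of 0] by simp
    fix \<beta> assume "\<beta> < \<delta>"
    then obtain n where "\<beta> < d n"
      using lub by blast
    \<comment> \<open>Cutting the union at the length of a member returns that member, together with
      its decisions.\<close>
    moreover have "cut_at u (d (Suc n)) = r (Suc n)"
      using cut_at_eq[OF u_r has_length_reaches[OF r(2)]] cut_at_self[OF r(2)] by simp
    ultimately have "decides D \<beta> (cut_at u (d (Suc n)))"
      using dec by simp
    then show "\<exists>\<gamma><\<delta>. decides D \<beta> (cut_at u \<gamma>)"
      using d_less by blast
  qed
  moreover have "(\<delta> \<^bold>\<in> B) u"
  proof -
    have "\<exists>y. \<exists>t\<le>s. (y \<^bold>\<in> B) t \<and> z < y \<and> y < \<delta>" if "z < \<delta>" "s \<le> u" for z s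
    proof -
      obtain n where "z < d n"
        using lub \<open>z < \<delta>\<close> by blast
      moreover obtain y where y: "d n < y" "y < d (Suc n)" "(y \<^bold>\<in> B) (r (Suc n))"
        using y by blast
      moreover have "(y \<^bold>\<in> B) s"
        using y(3) order_trans[OF \<open>s \<le> u\<close> u_r] by (rule fmem_mono)
      ultimately show ?thesis
        using d_less[of "Suc n"] by (intro exI[of _ y] exI[of _ s]) auto
    qed
    then show ?thesis
      using B uq d_less[of 0] unfolding club_G_iff by blast
  qed
  ultimately have "(\<delta> \<^bold>\<in> decided_part D \<gamma>0 B) u"
    by (simp add: fmem_decided_part has_length_reaches[OF u(1)])
  moreover have "x \<le> \<delta>"
    using d0(1) d_less[of 0] by simp
  ultimately show ?thesis
    using uq by blast
qed

text \<open>For closure, any \<beta> below a limit of decision points lies below one of them, whose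
  witness \<gamma> is still below the limit.\<close>

lemma decided_part_club:
  fixes q :: "'k::wellorder Q"
  assumes \<kappa>: "inaccessible (UNIV :: 'k set)" and B: "club_G UNIV B q"
  shows "club_G UNIV (decided_part D \<gamma>0 B) q"
  unfolding club_G_iff
proof (intro conjI ballI allI impI UNIV_I)
  show "\<exists>y. \<exists>r\<le>q'. (y \<^bold>\<in> decided_part D \<gamma>0 B) r \<and> x \<le> y" if "q' \<le> q" for x q'
    using decided_part_unbounded[OF \<kappa> regular_mono[OF regular_club_G B that]] .
next
  fix \<delta> q' assume ex: "\<exists>x. x < \<delta>" and q': "q' \<le> q"
    and lim: "\<forall>x<\<delta>. \<forall>r\<le>q'. \<exists>y. \<exists>s\<le>r. (y \<^bold>\<in> decided_part D \<gamma>0 B) s \<and> x < y \<and> y < \<delta>"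
  have lim: "\<exists>y s. s \<le> r \<and> y \<in> decision_points D \<gamma>0 s \<and> (y \<^bold>\<in> B) s \<and> x < y \<and> y < \<delta>"
    if "x < \<delta>" "r \<le> q'" for x r
  proof -
    obtain y s where s: "s \<le> r" "(y \<^bold>\<in> decided_part D \<gamma>0 B) s" "x < y" "y < \<delta>"
      using lim \<open>x < \<delta>\<close> \<open>r \<le> q'\<close> by blast
    then obtain t where "t \<le> s" "y \<in> decision_points D \<gamma>0 t" "(y \<^bold>\<in> B) t"
      unfolding fmem_decided_part_dense by blast
    moreover from this(1) s(1) have "t \<le> r"
      by (rule order_trans)
    ultimately show ?thesis
      using s(3,4) by blast
  qed
  show "(\<delta> \<^bold>\<in> decided_part D \<gamma>0 B) q'"
  proof (rule regular_dense[OF regular_fmem])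
    fix q'' assume q'': "q'' \<le> q'"
    obtain r where r: "r \<le> q''" "reaches r \<delta>"
      using reaches_extend .
    have rq': "r \<le> q'"
      using r(1) q'' by (rule order_trans)
    \<comment> \<open>The approximating points arise below different extensions, but as
      \<open>r\<close> reaches \<delta> they are all decision points of \<open>r\<close>
      itself.\<close>
    have lim': "\<exists>y. y \<in> decision_points D \<gamma>0 r \<and> x < y \<and> y < \<delta>" if "x < \<delta>" for x
    proof -
      obtain y s where s: "s \<le> r" "y \<in> decision_points D \<gamma>0 s" "x < y" "y < \<delta>"
        using lim[OF \<open>x < \<delta>\<close> rq'] by blast
      then have "y \<in> decision_points D \<gamma>0 r"
        using decision_points_stable[OF s(1) reaches_down[OF r(2)]] by simp
      with s show ?thesis by blast
    qed
    have "\<delta> \<in> decision_points D \<gamma>0 r"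
      unfolding decision_points_def
    proof (intro CollectI conjI allI impI)
      show "\<gamma>0 < \<delta>"
        using ex lim' less_trans unfolding decision_points_def by blast
      fix \<beta> assume "\<beta> < \<delta>"
      then obtain y where y: "y \<in> decision_points D \<gamma>0 r" "\<beta> < y" "y < \<delta>"
        using lim' by blast
      then obtain \<gamma> where "\<gamma> < y" "decides D \<beta> (cut_at r \<gamma>)"
        by (auto simp: decision_points_def)
      with y(3) show "\<exists>\<gamma><\<delta>. decides D \<beta> (cut_at r \<gamma>)"
        using less_trans by blast
    qed
    moreover have "(\<delta> \<^bold>\<in> B) r"
    proof -
      have "\<forall>x<\<delta>. \<forall>s\<le>r. \<exists>y. \<exists>t\<le>s. (y \<^bold>\<in> B) t \<and> x < y \<and> y < \<delta>"
        using lim order_trans[OF _ rq'] by blast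
      then show ?thesis
        using B ex order_trans[OF rq' q'] unfolding club_G_iff by blast
    qed
    ultimately show "\<exists>r\<le>q''. (\<delta> \<^bold>\<in> decided_part D \<gamma>0 B) r"
      using fmem_decided_part[OF r(2)] r(1) by blast
  qed
qed

text \<open>The decision points in a club \<open>B\<close> form a club, so \<open>D\<close> meets
  it; the meeting point lies both in \<open>B\<close> and in the decided part of
  \<open>D\<close>.\<close>

lemma decided_part_stationary:
  fixes q :: "'k::wellorder Q"
  assumes \<kappa>: "inaccessible (UNIV :: 'k set)" and D: "stationary_G UNIV D q"
  shows "stationary_G UNIV (decided_part D \<gamma>0 D) q"
  unfolding stationary_G_iff
proof (intro conjI allI impI UNIV_I)
  fix B :: "('k Q, 'k) name" and q' r
  assume q': "q' \<le> q" "r \<le> q'" and B: "club_G UNIV B q'"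
  obtain x s where s: "s \<le> r" "(x \<^bold>\<in> decided_part D \<gamma>0 B) s" "(x \<^bold>\<in> D) s"
    using D decided_part_club[OF \<kappa> B] q' unfolding stationary_G_iff by blast
  obtain t where t: "t \<le> s" "reaches t x"
    using reaches_extend .
  have "(x \<^bold>\<in> D) t" "(x \<^bold>\<in> decided_part D \<gamma>0 B) t"
    using s(2,3) t(1) by (auto intro: fmem_mono)
  then have "(x \<^bold>\<in> B) t \<and> (x \<^bold>\<in> decided_part D \<gamma>0 D) t"
    using fmem_decided_part[OF t(2)] by blast
  with order_trans[OF t(1) s(1)] show "\<exists>x. \<exists>s\<le>r. (x \<^bold>\<in> B) s \<and> (x \<^bold>\<in> decided_part D \<gamma>0 D) s"
    by blast
qed

text \<open>
  The top entry of a condition can be exchanged for any stationary subset that does not reflect,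
  since such a set is vacuously \<open>1\<close>-club and never has to cohere with the entries below it.
\<close>

lemma replace_top:
  fixes r :: "'k::wellorder Q"
  assumes i: "inaccessible {..<\<alpha>}" and r: "reaches r \<alpha>"
    and C: "stationary {..<\<alpha>} C"
    and nonrefl: "\<And>\<beta>. \<beta> < \<alpha> \<Longrightarrow> inaccessible {..<\<beta>} \<Longrightarrow> \<not> stationary {..<\<beta>} (C \<inter> {..<\<beta>})"
  obtains u where "Rep_Q u = (Rep_Q r |` {..<\<alpha>})(\<alpha> \<mapsto> C)"
proof -
  let ?m = "(Rep_Q r |` {..<\<alpha>})(\<alpha> \<mapsto> C)"
  have dom_r: "dom (Rep_Q r) \<subseteq> inacc"
    using dom_Rep_inacc inacc_iff by blast
  have dom: "dom ?m = inacc \<inter> {..\<alpha>}"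
    using r i dom_r unfolding reaches_def by (auto simp: inacc_iff[symmetric] le_less)
  have old: "\<beta> \<in> dom (Rep_Q r)" "?m \<beta> = Rep_Q r \<beta>" if "\<beta> \<in> dom ?m" "\<beta> \<noteq> \<alpha>" for \<beta>
    using that r unfolding dom reaches_def by (auto simp: restrict_map_def)
  have "is_condition ?m"
    unfolding is_condition_def
  proof (intro conjI ballI impI)
    show "\<exists>\<gamma>. dom ?m = inacc \<inter> {..\<gamma>}"
      using dom by blast
  next
    fix \<beta> assume \<beta>: "\<beta> \<in> dom ?m"
    show "one_club {..<\<beta>} (the (?m \<beta>))"
    proof (cases "\<beta> = \<alpha>")
      case True
      with C nonrefl show ?thesis
        by (auto simp: one_club_def)
    next
      case False
      show ?thesis
        using one_club_Rep[OF old(1)[OF \<beta> False]] old(2)[OF \<beta> False] by simp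
    qed
  next
    fix \<beta> \<gamma> assume \<beta>: "\<beta> \<in> dom ?m" and \<gamma>: "\<gamma> \<in> dom ?m"
      and st: "stationary {..<\<beta>} (the (?m \<gamma>) \<inter> {..<\<beta>})"
    have i\<beta>: "inaccessible {..<\<beta>}"
      using \<beta> unfolding dom by (simp add: inacc_iff)
    show "the (?m \<beta>) = the (?m \<gamma>) \<inter> {..<\<beta>}"
    proof (cases "\<gamma> = \<alpha>")
      case True
      then have "the (?m \<gamma>) = C"
        by simp
      with st nonrefl[OF _ i\<beta>] \<beta> have "\<beta> = \<alpha>"
        unfolding dom by (auto simp: le_less)
      moreover have "C \<subseteq> {..<\<alpha>}"
        using C by (simp add: stationary_def)
      ultimately show ?thesis
        using \<open>\<gamma> = \<alpha>\<close> by auto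
    next
      case False
      note \<gamma>' = old[OF \<gamma> False]
      have "the (?m \<gamma>) \<subseteq> {..<\<gamma>}"
        using subset_Rep[OF \<gamma>'(1)] \<gamma>'(2) by simp
      with stationary_restrict_le[OF i\<beta> st] have "\<beta> \<le> \<gamma>"
        by blast
      with False \<gamma> have "\<beta> \<noteq> \<alpha>"
        unfolding dom by auto
      note \<beta>' = old[OF \<beta> this]
      show ?thesis
        using coherent_Rep[OF \<beta>'(1) \<gamma>'(1)] st \<beta>'(2) \<gamma>'(2) by simp
    qed
  qed
  then show thesis
    using that Rep_Q_Abs_Q by blast
qed

section \<open>Refuting a thread under reflection\<close>

lemma generic_seq_no_thread:
  fixes q :: "'k::wellorder Q"
  assumes \<kappa>: "inaccessible (UNIV :: 'k set)"
    and refl: "Refl0_G (UNIV :: 'k set) q" and D: "stationary_G UNIV D q"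
    and thread: "\<And>\<alpha> r. r \<le> q \<Longrightarrow> inaccessible_G {..<\<alpha>} r \<Longrightarrow> stationary_G {..<\<alpha>} (D \<restriction> {..<\<alpha>}) r \<Longrightarrow>
       (generic_seq \<^bold>! \<alpha> \<^bold>= D \<restriction> {..<\<alpha>}) r"
  shows False
proof -
  obtain \<gamma>0 where \<gamma>0: "has_length q \<gamma>0"
    using has_length_exists by blast
  let ?S = "decided_part D \<gamma>0 D"
  \<comment> \<open>\<open>Y \<alpha> r\<close> is the part of \<open>?S\<close> below \<alpha> as
    seen by \<open>r\<close>, and \<open>R \<alpha>\<close> says that some extension of
    \<open>q\<close> makes it stationary at an inaccessible \<alpha>.\<close>
  define Y where "Y \<alpha> r = {\<delta>. \<delta> < \<alpha> \<and> \<delta> \<in> decision_points D \<gamma>0 r \<and> (\<delta> \<^bold>\<in> D) r}" for \<alpha> r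
  define R where "R \<alpha> \<longleftrightarrow> inaccessible {..<\<alpha>} \<and> (\<exists>r\<le>q. reaches r \<alpha> \<and> stationary {..<\<alpha>} (Y \<alpha> r))" for \<alpha>
  have "\<exists>\<alpha>. R \<alpha>"
  proof -
    \<comment> \<open>Reflection is applied to \<open>?S\<close>. After \<open>D\<close> is decided
      below the reflection point, \<open>Y\<close> is the true value of \<open>?S\<close>
      there.\<close>
    obtain \<alpha> s where s: "s \<le> q" "inaccessible_G {..<\<alpha>} s" "stationary_G {..<\<alpha>} (?S \<restriction> {..<\<alpha>}) s"
      using refl decided_part_stationary[OF \<kappa> D, of \<gamma>0] unfolding Refl0_G_iff by blast
    obtain t where t: "t \<le> s" "reaches t \<alpha>"
      using reaches_extend .
    obtain r where r: "r \<le> t" "\<forall>\<beta>\<in>{..<\<alpha>}. (\<beta> \<^bold>\<in> D) r \<or> (\<^bold>\<not> \<beta> \<^bold>\<in> D) r"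
      using Q_decide_set[OF \<kappa> inaccessible_lesspoll[OF \<kappa> UNIV_I]] .
    have reach: "reaches r \<beta>" if "\<beta> < \<alpha>" for \<beta>
      using reaches_down[OF reaches_mono[OF t(2) r(1)]] that by simp
    have "evaluates r (?S \<restriction> {..<\<alpha>}) (Y \<alpha> r)"
      unfolding evaluates_def
    proof (intro allI impI)
      fix r' x assume r': "r' \<le> r"
      show "(x \<^bold>\<in> ?S \<restriction> {..<\<alpha>}) r' \<longleftrightarrow> x \<in> Y \<alpha> r"
      proof (cases "x < \<alpha>")
        case True
        have "(x \<^bold>\<in> ?S) r' \<longleftrightarrow> x \<in> decision_points D \<gamma>0 r \<and> (x \<^bold>\<in> D) r'"
          using fmem_decided_part[OF reaches_mono[OF reach[OF True] r']]
            decision_points_stable[OF r' reach[OF True]] by blast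
        moreover have "(x \<^bold>\<in> D) r' \<longleftrightarrow> (x \<^bold>\<in> D) r"
          using r(2) True r' fmem_mono[of x D r r'] by (auto simp: fnot_iff)
        ultimately show ?thesis
          using True by (simp add: fmem_restrict Y_def)
      qed (simp add: fmem_restrict Y_def)
    qed
    moreover have "stationary_G {..<\<alpha>} (?S \<restriction> {..<\<alpha>}) r"
      using s(3) order_trans[OF r(1) t(1)] by (rule regular_mono[OF regular_stationary_G])
    ultimately have "stationary {..<\<alpha>} (Y \<alpha> r)"
      by (rule stationary_if_stationary_G)
    then have "R \<alpha>"
      unfolding R_def using inaccessible_if_inaccessible_G[OF s(2)] reaches_mono[OF t(2) r(1)]
        order_trans[OF order_trans[OF r(1) t(1)] s(1)] by blast
    then show ?thesis ..
  qed
  \<comment> \<open>Minimality over all extensions of \<open>q\<close> excludes reflection below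
    \<alpha>.\<close>
  define \<alpha> where "\<alpha> = (LEAST \<alpha>. R \<alpha>)"
  have "R \<alpha>"
    unfolding \<alpha>_def using \<open>\<exists>\<alpha>. R \<alpha>\<close> by (rule LeastI_ex)
  then obtain r where i: "inaccessible {..<\<alpha>}" and r: "r \<le> q" "reaches r \<alpha>"
    and st: "stationary {..<\<alpha>} (Y \<alpha> r)"
    unfolding R_def by blast
  \<comment> \<open>As \<open>Y \<alpha> r\<close> is unbounded in \<alpha>, cuts of
    \<open>r\<close> strictly below \<alpha> decide \<open>D\<close> everywhere below
    \<alpha>.\<close>
  have dec: "\<exists>\<gamma><\<alpha>. decides D \<beta> (cut_at r \<gamma>)" if "\<beta> < \<alpha>" for \<beta>
  proof -
    obtain y where "y \<in> Y \<alpha> r" "\<beta> < y"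
      using stationary_unbounded[OF i st, of \<beta>] \<open>\<beta> < \<alpha>\<close> by auto
    then show ?thesis
      unfolding Y_def decision_points_def using less_trans by blast
  qed
  obtain y0 where y0: "y0 \<in> Y \<alpha> r"
    using st club_self unfolding stationary_def by blast
  then have y0': "y0 < \<alpha>" "\<gamma>0 < \<alpha>"
    by (auto simp: Y_def decision_points_def)
  \<comment> \<open>The tail is still stationary, and the omitted point \<open>y0\<close> of
    \<open>D\<close> will separate it from the thread.\<close>
  define C where "C = Y \<alpha> r \<inter> {y0<..}"
  have C: "stationary {..<\<alpha>} C"
    unfolding C_def using stationary_tail[OF i st] y0'(1) by simp
  have "\<not> stationary {..<\<beta>} (C \<inter> {..<\<beta>})" if "\<beta> < \<alpha>" "inaccessible {..<\<beta>}" for \<beta>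
  proof
    assume "stationary {..<\<beta>} (C \<inter> {..<\<beta>})"
    then have "stationary {..<\<beta>} (Y \<beta> r)"
      by (rule stationary_mono) (auto simp: C_def Y_def)
    then have "R \<beta>"
      unfolding R_def using that(2) r reaches_down[OF r(2) less_imp_le[OF that(1)]] by blast
    then show False
      using not_less_Least that(1) unfolding \<alpha>_def by blast
  qed
  then obtain u where u: "Rep_Q u = (Rep_Q r |` {..<\<alpha>})(\<alpha> \<mapsto> C)"
    using replace_top[OF i r(2) C] by blast
  \<comment> \<open>Although \<open>u\<close> need not extend \<open>r\<close>, it extends all cuts
    of \<open>r\<close> below \<alpha> and inherits their decisions about \<open>D\<close>.\<close>
  have u_cut_at: "u \<le> cut_at r \<gamma>" if "\<gamma> < \<alpha>" for \<gamma>
    using that by (auto simp: le_Q_iff Rep_cut_at u map_le_def restrict_map_def)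
  \<comment> \<open>The length of \<open>q\<close> is below \<alpha>, so the changed entry lies
    beyond \<open>q\<close>.\<close>
  have "cut_at r \<gamma>0 = q"
    using cut_at_eq[OF r(1) has_length_reaches[OF \<gamma>0]] cut_at_self[OF \<gamma>0] by simp
  with u_cut_at[OF y0'(2)] have uq: "u \<le> q"
    by simp
  define X where "X = {x \<in> {..<\<alpha>}. (x \<^bold>\<in> D) u}"
  have ev: "evaluates u (D \<restriction> {..<\<alpha>}) X"
    unfolding X_def
  proof (rule evaluates_restrictI)
    fix x assume "x \<in> {..<\<alpha>}"
    then obtain \<gamma> where \<gamma>: "\<gamma> < \<alpha>" "decides D x (cut_at r \<gamma>)"
      using dec by auto
    have "decides D x u"
      using \<gamma>(2) u_cut_at[OF \<gamma>(1)] by (rule decides_mono)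
    then show "(x \<^bold>\<in> D) u \<or> (\<^bold>\<not> x \<^bold>\<in> D) u"
      by (simp add: decides_def)
  qed
  \<comment> \<open>What \<open>r\<close> forces into \<open>D\<close> below \<alpha>, a cut of
    \<open>r\<close> has decided positively, since \<open>r\<close> extends the cut;
    \<open>u\<close> extends it as well.\<close>
  have YX: "Y \<alpha> r \<subseteq> X"
  proof
    fix y assume "y \<in> Y \<alpha> r"
    then have y: "y < \<alpha>" "(y \<^bold>\<in> D) r"
      by (auto simp: Y_def)
    then obtain \<gamma> where \<gamma>: "\<gamma> < \<alpha>" "decides D y (cut_at r \<gamma>)"
      using dec by blast
    then have "(y \<^bold>\<in> D) (cut_at r \<gamma>)"
      using y(2) le_cut_at[of r \<gamma>] by (auto simp: decides_def fnot_iff)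
    then have "(y \<^bold>\<in> D) u"
      using u_cut_at[OF \<gamma>(1)] by (rule fmem_mono)
    with y(1) show "y \<in> X"
      by (simp add: X_def)
  qed
  have "stationary {..<\<alpha>} X"
    using C by (rule stationary_mono) (use YX in \<open>auto simp: C_def X_def\<close>)
  \<comment> \<open>Thus \<open>u\<close> forces the thread to reflect at \<alpha> and to agree
    there with the generic entry, which is \<open>C\<close>.\<close>
  then have "stationary_G {..<\<alpha>} (D \<restriction> {..<\<alpha>}) u"
    using stationary_G_absolute[OF \<kappa> inaccessible_lesspoll[OF \<kappa> UNIV_I] ev] by blast
  then have "(generic_seq \<^bold>! \<alpha> \<^bold>= D \<restriction> {..<\<alpha>}) u"
    using thread[OF uq] inaccessible_G_if_inaccessible[OF \<kappa> i] by blast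
  moreover have "evaluates u (generic_seq \<^bold>! \<alpha>) C"
    using evaluates_generic_seq[of \<alpha> u] by (simp add: u)
  ultimately have "C = X"
    using evaluates_feq ev by blast
  moreover have "y0 \<in> X" "y0 \<notin> C"
    using y0 YX by (auto simp: C_def)
  ultimately show False
    by blast
qed

text \<open>The generic sequence is the witness below every condition; reflection persists to the
  extension that forces the supposed thread.\<close>

lemma square1_G_if_Refl0_G:
  fixes p :: "'k::wellorder Q"
  assumes \<kappa>: "inaccessible (UNIV :: 'k set)" and refl: "Refl0_G (UNIV :: 'k set) p"
  shows "square1_G (UNIV :: 'k set) p"
proof -
  have "square_seq_G (UNIV :: 'k set) generic_seq q" if "q \<le> p" for q
    unfolding square_seq_G_def
  proof (intro conjI ballI allI impI notI)
    show "one_club_G {..<\<alpha>} (generic_seq \<^bold>! \<alpha>) r" if "inaccessible_G {..<\<alpha>} r" for \<alpha> :: 'k and r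
      using generic_seq_one_club[OF \<kappa> that] .
    show "(generic_seq \<^bold>! \<alpha> \<^bold>= generic_seq \<^bold>! \<beta> \<restriction> {..<\<alpha>}) r"
      if "\<alpha> \<in> UNIV \<and> \<beta> \<in> UNIV \<and> \<alpha> < \<beta>" "inaccessible_G {..<\<alpha>} r \<and> inaccessible_G {..<\<beta>} r \<and>
        stationary_G {..<\<alpha>} (generic_seq \<^bold>! \<beta> \<restriction> {..<\<alpha>}) r" for \<alpha> \<beta> :: 'k and r
      using generic_seq_coherent that by blast
  next
    fix D :: "('k Q, 'k) name" and r assume r: "r \<le> q"
      and D: "one_club_G UNIV D r \<and> (\<forall>\<alpha>\<in>UNIV. \<forall>s\<le>r. inaccessible_G {..<\<alpha>} s \<and>
        stationary_G {..<\<alpha>} (D \<restriction> {..<\<alpha>}) s \<longrightarrow> (generic_seq \<^bold>! \<alpha> \<^bold>= D \<restriction> {..<\<alpha>}) s)"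
    have "r \<le> p"
      using r \<open>q \<le> p\<close> by (rule order_trans)
    moreover have "regular_sentence (Refl0_G (UNIV :: 'k set) :: 'k Q sentence)"
      by (simp add: Refl0_G_def)
    ultimately have "Refl0_G (UNIV :: 'k set) r"
      using refl regular_mono by blast
    moreover have "stationary_G UNIV D r"
      using D by (simp add: one_club_G_iff)
    ultimately show False
      by (rule generic_seq_no_thread[OF \<kappa>]) (use D in blast)
  qed
  then show ?thesis
    unfolding square1_G_iff by blast
qed

theorem theorem5p9:
  fixes p :: "'k::wellorder Q"
  assumes "Mahlo (UNIV :: 'k set)"
  shows "(p \<tturnstile> Refl0_G (UNIV :: 'k set)) \<longleftrightarrow> (p \<tturnstile> square1_G (UNIV :: 'k set))"
proof -
  have \<kappa>: "inaccessible (UNIV :: 'k set)"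
    using assms by (simp add: Mahlo_def)
  \<comment> \<open>Absoluteness supplies the inaccessibility of \<kappa> in the extension, which
    \<open>Refl0_G\<close> includes but \<open>square1_G\<close> does not assert.\<close>
  show ?thesis
    unfolding forces_def
    using square1_G_if_Refl0_G[OF \<kappa>] Refl0_G_if_square1_G inaccessible_G_if_inaccessible[OF \<kappa> \<kappa>]
    by blast
qed

end
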